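(* Let $n\in\mathbb{N}$. Assume that $\varphi_0,\varphi_1\in RO$ and that $\frac{\varphi_0}{\varphi_1}$ is bounded in a neighborhood of $\infty$. Let $\psi\in\mathcal{B}$ be an interpolation parameter. Then the following hold: (i) $[H^{\varphi_0}(\mathbb{Z}^n),H^{\varphi_1}(\mathbb{Z}^n)]$ is an admissible pair; (ii) up to norm equivalence, $$[H^{\varphi_0}(\mathbb{Z}^n),H^{\varphi_1}(\mathbb{Z}^n)]_{\psi}=H^{\varphi}(\mathbb{Z}^n),\qquad\text{where}\quad \varphi(t):=\varphi_0(t)\,\psi\!\left(\frac{\varphi_1(t)}{\varphi_0(t)}\right),\quad t\geq1.$$
   Context: Notation on $\mathbb{Z}^n$: $|k|=\sqrt{k_1^2+\dots+k_n^2}$ and $\langle k\rangle=(1+|k|^2)^{1/2}$. $\ell^2(\mathbb{Z}^n)$ is the Hilbert space of square summable functions $u\colon\mathbb{Z}^n\to\mathbb{C}$ with inner product $(u,v)=\sum_{k\in\mathbb{Z}^n}u(k)\overline{v(k)}$. $\mathcal{S}(\mathbb{Z}^n)$ is the Schwartz space of functions $u\colon\mathbb{Z}^n\to\mathbb{C}$ with $\sup_{k}|k^{\alpha}(\Delta_k^{\beta}u)(k)|<\infty$ for all $\alpha,\beta\in\mathbb{N}_0^n$, where $\Delta_{k_j}u(k)=u(k+e_j)-u(k)$ and $\Delta_k^\beta=\Delta_{k_1}^{\beta_1}\cdots\Delta_{k_n}^{\beta_n}$. $\mathcal{S}'(\mathbb{Z}^n)$ is the space of continuous linear functionals on $\mathcal{S}(\mathbb{Z}^n)$,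 identified with functions $u\colon\mathbb{Z}^n\to\mathbb{C}$ of at most polynomial growth acting by $v\mapsto\sum_k u(k)v(k)$. $RO$-varying functions: $\varphi\in RO$ means that $\varphi\colon[1,\infty)\to(0,\infty)$ is Borel measurable and there exist $a>1$, $c\geq1$ with $c^{-1}\leq\varphi(\lambda t)/\varphi(t)\leq c$ for all $t\geq1$, $\lambda\in[1,a]$. For $\varphi\in RO$, $H^{\varphi}(\mathbb{Z}^n)=\{u\in\mathcal{S}'(\mathbb{Z}^n):\varphi(\langle k\rangle)u\in\ell^2(\mathbb{Z}^n)\}$ with inner product $(u,v)_{H^{\varphi}(\mathbb{Z}^n)}=\sum_{k\in\mathbb{Z}^n}[\varphi(\langle k\rangle)]^2u(k)\overline{v(k)}$. The notation $H^\varphi(\mathbb{Z}^n)$ is defined only for $\varphi\in RO$, so its use in the claim presupposes $\varphi\in RO$. Interpolation with a function parameter: an admissible pair is an ordered pair $\mathscr{H}=[\mathscr{H}_0,\mathscr{H}_1]$ of separable complex Hilbert spaces with continuous and dense embedding $\mathscr{H}_1\hookrightarrow\mathscr{H}_0$. It has a unique generating operator $J$: a positive self-adjoint operator in $\mathscr{H}_0$ with $\operatorname{Dom}(J)=\mathscr{H}_1$ and $\|Ju\|_{\mathscr{H}_0}=\|u\|_{\mathscr{H}_1}$ for $u\in\mathscr{H}_1$. $\mathcal{B}$ is the set of Borel measurable functions $\psi\colon(0,\infty)\to(0,\infty)$ such that $\psi$ is bounded on every $[a,b]$ with $0<a<b<\infty$ and $1/\psi$ is bounded on every $(c,\infty)$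 with $c>0$. For $\psi\in\mathcal{B}$, $\psi(J)$ is defined by spectral calculus and $\mathscr{H}_\psi=[\mathscr{H}_0,\mathscr{H}_1]_\psi:=\operatorname{Dom}(\psi(J))$ with inner product $(u,v)_{\mathscr{H}_\psi}=(\psi(J)u,\psi(J)v)_{\mathscr{H}_0}$. A function $\psi\in\mathcal{B}$ is an interpolation parameter if for all admissible pairs $\mathscr{H}=[\mathscr{H}_0,\mathscr{H}_1]$, $\mathscr{K}=[\mathscr{K}_0,\mathscr{K}_1]$ and all linear operators $T$ with $\mathscr{H}_0\subseteq\operatorname{Dom}(T)$: if the restrictions of $T$ are bounded operators $\mathscr{H}_0\to\mathscr{K}_0$ and $\mathscr{H}_1\to\mathscr{K}_1$, then the restriction of $T$ to $\mathscr{H}_\psi$ is a bounded operator $\mathscr{H}_\psi\to\mathscr{K}_\psi$. "Up to norm equivalence" means the two spaces coincide as vector spaces and their norms are equivalent. *)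

theory Defs
  imports "HOL-Analysis.Analysis" "HOL-Library.Function_Algebras"
begin

section \<open>Complex vector spaces and Hilbert spaces\<close>

class complex_vector = ab_group_add +
  fixes scaleC :: "complex \<Rightarrow> 'a \<Rightarrow> 'a" (infixr "*\<^sub>C" 75)
  assumes scaleC_add_right: "a *\<^sub>C (x + y) = a *\<^sub>C x + a *\<^sub>C y"
    and scaleC_add_left: "(a + b) *\<^sub>C x = a *\<^sub>C x + b *\<^sub>C x"
    and scaleC_scaleC: "a *\<^sub>C b *\<^sub>C x = (a * b) *\<^sub>C x"
    and scaleC_one: "1 *\<^sub>C x = x"

interpretation complex_vector: vector_space "scaleC :: complex \<Rightarrow> 'a \<Rightarrow> 'a::complex_vector"
  by unfold_locales
    (simp_all add: scaleC_add_right scaleC_add_left scaleC_scaleC scaleC_one)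

instantiation complex :: complex_vector
begin

definition scaleC_complex :: "complex \<Rightarrow> complex \<Rightarrow> complex"
  where "scaleC_complex c z = c * z"

instance
  by standard (simp_all add: scaleC_complex_def algebra_simps)

end

instantiation "fun" :: (type, complex_vector) complex_vector
begin

definition scaleC_fun :: "complex \<Rightarrow> ('a \<Rightarrow> 'b) \<Rightarrow> 'a \<Rightarrow> 'b"
  where "scaleC_fun c f = (\<lambda>x. c *\<^sub>C f x)"

instance
  by standard
    (simp_all add: scaleC_fun_def fun_eq_iff
      scaleC_add_right scaleC_add_left scaleC_scaleC scaleC_one)

end

text \<open>
  A Hilbert space is a linear subspace of an ambient complex vector space, together with an inner
  product of its own. Two spaces inside the same ambient type share the vector space operations,
  so an embedding of one into the other is simply an inclusion of carriers. The inner product is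
  relevant on the carrier only.
\<close>

record 'a hspace =
  hcarrier :: "'a set"
  hinner :: "'a \<Rightarrow> 'a \<Rightarrow> complex"

definition hnorm :: "'a hspace \<Rightarrow> 'a \<Rightarrow> real"
  where "hnorm H u = sqrt (Re (hinner H u u))"

text \<open>
  The value 0 off the carrier is needed because the locale \<open>Metric_space\<close> demands nonnegativity and
  symmetry of the distance on the whole type.
\<close>

definition hdist :: "'a::complex_vector hspace \<Rightarrow> 'a \<Rightarrow> 'a \<Rightarrow> real"
  where "hdist H u v = (if u \<in> hcarrier H \<and> v \<in> hcarrier H then hnorm H (u - v) else 0)"

abbreviation htopology :: "'a::complex_vector hspace \<Rightarrow> 'a topology"
  where "htopology H \<equiv> Metric_space.mtopology (hcarrier H) (hdist H)"

definition linear_on :: "'a::complex_vector set \<Rightarrow> ('a \<Rightarrow> 'b::complex_vector) \<Rightarrow> bool"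
  where "linear_on D T \<longleftrightarrow>
    (\<forall>u\<in>D. \<forall>v\<in>D. T (u + v) = T u + T v) \<and> (\<forall>c. \<forall>u\<in>D. T (c *\<^sub>C u) = c *\<^sub>C T u)"

definition hilbert_space :: "'a::complex_vector hspace \<Rightarrow> bool"
  where "hilbert_space H \<longleftrightarrow>
    module.subspace scaleC (hcarrier H) \<and>
    (\<forall>v\<in>hcarrier H. linear_on (hcarrier H) (\<lambda>u. hinner H u v)) \<and>
    (\<forall>u\<in>hcarrier H. \<forall>v\<in>hcarrier H. hinner H u v = cnj (hinner H v u)) \<and>
    (\<forall>u\<in>hcarrier H. u \<noteq> 0 \<longrightarrow> 0 < Re (hinner H u u)) \<and>
    Metric_space.mcomplete (hcarrier H) (hdist H)"

definition separable_hilbert_space :: "'a::complex_vector hspace \<Rightarrow> bool"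
  where "separable_hilbert_space H \<longleftrightarrow> hilbert_space H \<and> separable_space (htopology H)"

definition bounded_operator ::
    "'a::complex_vector hspace \<Rightarrow> 'b::complex_vector hspace \<Rightarrow> ('a \<Rightarrow> 'b) \<Rightarrow> bool"
  where "bounded_operator H K T \<longleftrightarrow>
    T \<in> hcarrier H \<rightarrow> hcarrier K \<and> linear_on (hcarrier H) T \<and>
    (\<exists>C. \<forall>u\<in>hcarrier H. hnorm K (T u) \<le> C * hnorm H u)"

definition equal_up_to_norm_equivalence ::
    "'a::complex_vector hspace \<Rightarrow> 'a hspace \<Rightarrow> bool"
  where "equal_up_to_norm_equivalence H K \<longleftrightarrow>
    hcarrier H = hcarrier K \<and>
    (\<exists>c>0. \<exists>C>0. \<forall>u\<in>hcarrier H. c * hnorm H u \<le> hnorm K u \<and> hnorm K u \<le> C * hnorm H u)"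

definition admissible_pair :: "'a::complex_vector hspace \<Rightarrow> 'a hspace \<Rightarrow> bool"
  where "admissible_pair H0 H1 \<longleftrightarrow>
    separable_hilbert_space H0 \<and> separable_hilbert_space H1 \<and>
    hcarrier H1 \<subseteq> hcarrier H0 \<and>
    continuous_map (htopology H1) (htopology H0) (\<lambda>u. u) \<and>
    htopology H0 closure_of hcarrier H1 = hcarrier H0"


section \<open>Unbounded operators and spectral calculus\<close>

text \<open>
  An operator in \<open>H\<close> with domain \<open>D\<close> is a function \<open>J \<in> D \<rightarrow>\<^sub>E hcarrier H\<close>, that is, with the fixed
  value \<open>undefined\<close> off \<open>D\<close>. This makes the operators below unique as functions, so that they can be
  introduced by definite description. The third conjunct says that the graph of \<open>J\<close> is the graph of
  its adjoint.
\<close>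

definition positive_selfadjoint ::
    "'a::complex_vector hspace \<Rightarrow> 'a set \<Rightarrow> ('a \<Rightarrow> 'a) \<Rightarrow> bool"
  where "positive_selfadjoint H D J \<longleftrightarrow>
    J \<in> D \<rightarrow>\<^sub>E hcarrier H \<and>
    (D \<subseteq> hcarrier H \<and> module.subspace scaleC D \<and>
      htopology H closure_of D = hcarrier H \<and> linear_on D J) \<and>
    (\<forall>v\<in>hcarrier H. \<forall>w\<in>hcarrier H.
      v \<in> D \<and> J v = w \<longleftrightarrow> (\<forall>u\<in>D. hinner H (J u) v = hinner H u w)) \<and>
    (\<forall>u\<in>D. u \<noteq> 0 \<longrightarrow> 0 < Re (hinner H (J u) u))"

definition generating_operator ::
    "'a::complex_vector hspace \<Rightarrow> 'a hspace \<Rightarrow> 'a \<Rightarrow> 'a"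
  where "generating_operator H0 H1 =
    (THE J. positive_selfadjoint H0 (hcarrier H1) J \<and>
      (\<forall>u\<in>hcarrier H1. hnorm H0 (J u) = hnorm H1 u))"

definition orthogonal_projection :: "'a::complex_vector hspace \<Rightarrow> ('a \<Rightarrow> 'a) \<Rightarrow> bool"
  where "orthogonal_projection H P \<longleftrightarrow>
    P \<in> hcarrier H \<rightarrow>\<^sub>E hcarrier H \<and> linear_on (hcarrier H) P \<and>
    (\<forall>u\<in>hcarrier H. P (P u) = P u) \<and>
    (\<forall>u\<in>hcarrier H. \<forall>v\<in>hcarrier H. hinner H (P u) v = hinner H u (P v))"

definition projection_valued_measure ::
    "'a::complex_vector hspace \<Rightarrow> (real set \<Rightarrow> 'a \<Rightarrow> 'a) \<Rightarrow> bool"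
  where "projection_valued_measure H E \<longleftrightarrow>
    E \<in> sets borel \<rightarrow>\<^sub>E {P. orthogonal_projection H P} \<and>
    (\<forall>u\<in>hcarrier H. E UNIV u = u) \<and>
    (\<forall>A\<in>sets borel. \<forall>B\<in>sets borel. \<forall>u\<in>hcarrier H. E (A \<inter> B) u = E A (E B u)) \<and>
    (\<forall>A :: nat \<Rightarrow> real set. range A \<subseteq> sets borel \<longrightarrow> disjoint_family A \<longrightarrow>
      (\<forall>u\<in>hcarrier H. (\<lambda>n. hnorm H (E (\<Union>i. A i) u - (\<Sum>i<n. E (A i) u))) \<longlonglongrightarrow> 0))"

text \<open>The measure \<open>B \<mapsto> (E(B)u, u)\<close>.\<close>

definition scalar_measure ::
    "'a::complex_vector hspace \<Rightarrow> (real set \<Rightarrow> 'a \<Rightarrow> 'a) \<Rightarrow> 'a \<Rightarrow> real measure"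
  where "scalar_measure H E u =
    measure_of UNIV (sets borel) (\<lambda>B. ennreal (Re (hinner H (E B u) u)))"

text \<open>
  For real Borel measurable \<open>f\<close>, the self-adjoint operator \<open>A = \<integral> f dE\<close> has the domain of all \<open>u\<close> with
  \<open>\<integral> f\<^sup>2 d(Eu, u) < \<infinity>\<close> and is determined there by \<open>(A u, u) = \<integral> f d(Eu, u)\<close>: by polarization these
  values give \<open>(A u, v)\<close> for all \<open>u\<close> and \<open>v\<close> in the domain, which is dense.
\<close>

definition spectral_integral_dom ::
    "'a::complex_vector hspace \<Rightarrow> (real set \<Rightarrow> 'a \<Rightarrow> 'a) \<Rightarrow> (real \<Rightarrow> real) \<Rightarrow> 'a set"
  where "spectral_integral_dom H E f =
    {u \<in> hcarrier H. integrable (scalar_measure H E u) (\<lambda>t. (f t)\<^sup>2)}"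

definition spectral_integral ::
    "'a::complex_vector hspace \<Rightarrow> (real set \<Rightarrow> 'a \<Rightarrow> 'a) \<Rightarrow> (real \<Rightarrow> real) \<Rightarrow> 'a \<Rightarrow> 'a"
  where "spectral_integral H E f =
    (THE A. A \<in> spectral_integral_dom H E f \<rightarrow>\<^sub>E hcarrier H \<and>
      linear_on (spectral_integral_dom H E f) A \<and>
      (\<forall>u\<in>spectral_integral_dom H E f.
        hinner H (A u) u = complex_of_real (\<integral>t. f t \<partial>scalar_measure H E u)))"

text \<open>The resolution of the identity of the self-adjoint operator \<open>J\<close> with domain \<open>D\<close>.\<close>

definition spectral_resolution ::
    "'a::complex_vector hspace \<Rightarrow> 'a set \<Rightarrow> ('a \<Rightarrow> 'a) \<Rightarrow> real set \<Rightarrow> 'a \<Rightarrow> 'a"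
  where "spectral_resolution H D J =
    (THE E. projection_valued_measure H E \<and>
      spectral_integral_dom H E (\<lambda>t. t) = D \<and> spectral_integral H E (\<lambda>t. t) = J)"


section \<open>Interpolation with a function parameter\<close>

definition class_B :: "(real \<Rightarrow> real) set"
  where "class_B = {\<psi>.
    \<psi> \<in> borel_measurable (restrict_space borel {0<..}) \<and>
    (\<forall>t>0. 0 < \<psi> t) \<and>
    (\<forall>a b. 0 < a \<longrightarrow> a < b \<longrightarrow> bounded (\<psi> ` {a..b})) \<and>
    (\<forall>c>0. bounded ((\<lambda>t. 1 / \<psi> t) ` {c<..}))}"

text \<open>
  The parameter \<open>\<psi>\<close> is a function on \<open>(0,\<infinity>)\<close>. It is extended by 0 to the real line, on which the
  spectral measure lives; since \<open>J\<close> is positive, its spectral measure vanishes on \<open>(-\<infinity>,0]\<close>.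
\<close>

definition interpolation_space ::
    "'a::complex_vector hspace \<Rightarrow> 'a hspace \<Rightarrow> (real \<Rightarrow> real) \<Rightarrow> 'a hspace"
  where "interpolation_space H0 H1 \<psi> =
    (let J = generating_operator H0 H1;
         E = spectral_resolution H0 (hcarrier H1) J;
         f = (\<lambda>t. if 0 < t then \<psi> t else 0);
         \<psi>J = spectral_integral H0 E f
     in \<lparr>hcarrier = spectral_integral_dom H0 E f,
         hinner = (\<lambda>u v. hinner H0 (\<psi>J u) (\<psi>J v))\<rparr>)"

text \<open>
  A formula cannot quantify over types, so the admissible pairs range over the Hilbert spaces with
  carrier in \<open>nat \<Rightarrow> complex\<close>. This is no restriction: a separable \<open>H0\<close> is unitarily equivalent to
  \<open>\<ell>\<^sup>2\<close> over the naturals or over an initial segment of them, the unitary map transports \<open>H1\<close> along,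
  and it carries interpolation spaces to interpolation spaces. Only the restriction of \<open>T\<close> to
  \<open>hcarrier H0\<close> matters.
\<close>

definition interpolation_parameter :: "(real \<Rightarrow> real) \<Rightarrow> bool"
  where "interpolation_parameter \<psi> \<longleftrightarrow> \<psi> \<in> class_B \<and>
    (\<forall>(H0 :: (nat \<Rightarrow> complex) hspace) H1 (K0 :: (nat \<Rightarrow> complex) hspace) K1 T.
      admissible_pair H0 H1 \<longrightarrow> admissible_pair K0 K1 \<longrightarrow>
      bounded_operator H0 K0 T \<longrightarrow> bounded_operator H1 K1 T \<longrightarrow>
      bounded_operator (interpolation_space H0 H1 \<psi>) (interpolation_space K0 K1 \<psi>) T)"


section \<open>RO-varying functions and the spaces on the lattice\<close>

text \<open>Only the values on \<open>[1,\<infinity>)\<close> are relevant.\<close>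

definition RO :: "(real \<Rightarrow> real) set"
  where "RO = {\<phi>.
    \<phi> \<in> borel_measurable (restrict_space borel {1..}) \<and>
    (\<forall>t\<ge>1. 0 < \<phi> t) \<and>
    (\<exists>a>1. \<exists>c\<ge>1. \<forall>t\<ge>1. \<forall>s\<in>{1..a}. 1 / c \<le> \<phi> (s * t) / \<phi> t \<and> \<phi> (s * t) / \<phi> t \<le> c)}"

definition lattice_norm :: "int ^ 'n \<Rightarrow> real"
  where "lattice_norm k = sqrt (\<Sum>j\<in>UNIV. (real_of_int (k $ j))\<^sup>2)"

definition bracket :: "int ^ 'n \<Rightarrow> real"
  where "bracket k = sqrt (1 + (lattice_norm k)\<^sup>2)"

text \<open>
  The dual of the Schwartz space on the lattice, identified with the functions of at most
  polynomial growth.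
\<close>

definition tempered :: "(int ^ 'n \<Rightarrow> complex) set"
  where "tempered = {u. \<exists>C. \<exists>N::nat. \<forall>k. cmod (u k) \<le> C * bracket k ^ N}"

definition ell2 :: "('i \<Rightarrow> complex) set"
  where "ell2 = {u. (\<lambda>k. (cmod (u k))\<^sup>2) summable_on UNIV}"

definition H_space :: "(real \<Rightarrow> real) \<Rightarrow> (int ^ 'n \<Rightarrow> complex) hspace"
  where "H_space \<phi> =
    \<lparr>hcarrier = {u \<in> tempered. (\<lambda>k. complex_of_real (\<phi> (bracket k)) * u k) \<in> ell2},
     hinner = (\<lambda>u v. \<Sum>\<^sub>\<infinity>k. (complex_of_real (\<phi> (bracket k)))\<^sup>2 * u k * cnj (v k))\<rparr>"

end

theory Submission
  imports Defs
begin

text \<open>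
  Everything takes place in weighted spaces: \<open>H_space \<phi>\<close> is the \<open>\<ell>\<^sup>2\<close> space on the lattice with weight
  \<open>\<phi>(\<langle>k\<rangle>)\<close>. The growth condition hidden in \<open>tempered\<close> is automatic, because a function in \<open>RO\<close> is
  bounded below by a negative power (\<open>RO_polynomial_lower_bound\<close>, \<open>H_space_eq_weighted_l2\<close>).

  For weights \<open>w0\<close>, \<open>w1\<close> on a countable index set with \<open>w1 \<ge> r w0\<close> for some \<open>r > 0\<close>, the pair of weighted
  spaces is admissible, its generating operator is multiplication by \<open>m = w1 / w0\<close>, and the spectral
  projection of a Borel set \<open>B\<close> is multiplication by the indicator of \<open>m \<in> B\<close>. Hence \<open>\<psi>(J)\<close> is
  multiplication by \<open>\<psi>(m)\<close>, and the interpolation space is the weighted space with weight \<open>w0 \<psi>(m)\<close>,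
  with the same norm (\<open>interpolation_space_weighted\<close>). The boundedness of \<open>\<phi>0 / \<phi>1\<close> near infinity,
  together with the two-sided bounds of \<open>RO\<close> functions on compact intervals, provides such an \<open>r\<close>.

  The operators involved are introduced by definite descriptions, so their uniqueness is part of the
  proof. Uniqueness of the generating operator comes from the unit vectors, which every competitor must
  have as eigenvectors (\<open>generating_operator_eq\<close>). Uniqueness of the spectral resolution needs the spectral
  integral of the identity for an arbitrary projection-valued measure, with its first two moments
  (\<open>spectral_integral_properties\<close>): the moments force the measure of a unit vector to be a point mass
  (\<open>spectral_resolution_eq\<close>).

  It remains to see that \<open>\<phi> = \<phi>0 \<psi>(\<phi>1 / \<phi>0)\<close> is in \<open>RO\<close>. This requires \<open>\<psi>(t) \<le> C \<psi>(s)\<close> for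
  \<open>s, t \<ge> r\<close> with \<open>s / t\<close> and \<open>t / s\<close> bounded. Peetre's theorem, that interpolation parameters are
  pseudoconcave near infinity, would give it, but one operator suffices: if the estimate failed along pairs
  \<open>(s, t)\<close>, exchanging the unit vectors belonging to \<open>s\<close> and \<open>t\<close> would be bounded on the two weighted
  spaces over the naturals and unbounded on the interpolation space (\<open>interpolation_parameter_comparable\<close>).
\<close>

section \<open>Geometry of inner product spaces given by carriers\<close>

text \<open>
  The conditions of \<open>hilbert_space\<close> other than completeness. They already turn \<open>hdist\<close> into a metric,
  which is what the completeness condition and the topology refer to.
\<close>

locale pre_hilbert =
  fixes H :: "'a::complex_vector hspace"
  assumes subspace: "complex_vector.subspace (hcarrier H)"
    and inner_linear: "v \<in> hcarrier H \<Longrightarrow> linear_on (hcarrier H) (\<lambda>u. hinner H u v)"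
    and inner_commute:
      "u \<in> hcarrier H \<Longrightarrow> v \<in> hcarrier H \<Longrightarrow> hinner H u v = cnj (hinner H v u)"
    and inner_pos: "u \<in> hcarrier H \<Longrightarrow> u \<noteq> 0 \<Longrightarrow> 0 < Re (hinner H u u)"
begin

lemma zero_mem [simp]: "0 \<in> hcarrier H"
  using subspace by (rule complex_vector.subspace_0)

lemma add_mem [simp]: "u \<in> hcarrier H \<Longrightarrow> v \<in> hcarrier H \<Longrightarrow> u + v \<in> hcarrier H"
  using subspace by (rule complex_vector.subspace_add)

lemma diff_mem [simp]: "u \<in> hcarrier H \<Longrightarrow> v \<in> hcarrier H \<Longrightarrow> u - v \<in> hcarrier H"
  using subspace by (rule complex_vector.subspace_diff)

lemma scale_mem [simp]: "u \<in> hcarrier H \<Longrightarrow> c *\<^sub>C u \<in> hcarrier H"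
  using subspace by (rule complex_vector.subspace_scale)

lemma sum_mem: "(\<And>i. i \<in> I \<Longrightarrow> f i \<in> hcarrier H) \<Longrightarrow> sum f I \<in> hcarrier H"
  using subspace by (rule complex_vector.subspace_sum)

lemma inner_add_left:
  "\<lbrakk>u \<in> hcarrier H; u' \<in> hcarrier H; v \<in> hcarrier H\<rbrakk>
    \<Longrightarrow> hinner H (u + u') v = hinner H u v + hinner H u' v"
  using inner_linear[of v] by (simp add: linear_on_def)

lemma inner_scale_left:
  "\<lbrakk>u \<in> hcarrier H; v \<in> hcarrier H\<rbrakk> \<Longrightarrow> hinner H (c *\<^sub>C u) v = c * hinner H u v"
  using inner_linear[of v] by (simp add: linear_on_def scaleC_complex_def)

lemma inner_diff_left:
  assumes "u \<in> hcarrier H" "u' \<in> hcarrier H" "v \<in> hcarrier H"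
  shows "hinner H (u - u') v = hinner H u v - hinner H u' v"
  using inner_add_left[of "u - u'" u' v] assms by simp

lemma inner_zero_left [simp]: "v \<in> hcarrier H \<Longrightarrow> hinner H 0 v = 0"
  using inner_diff_left[of 0 0 v] by simp

lemma inner_add_right:
  "\<lbrakk>u \<in> hcarrier H; v \<in> hcarrier H; v' \<in> hcarrier H\<rbrakk>
    \<Longrightarrow> hinner H u (v + v') = hinner H u v + hinner H u v'"
  by (subst (1 2 3) inner_commute) (auto simp: inner_add_left)

lemma inner_scale_right:
  "\<lbrakk>u \<in> hcarrier H; v \<in> hcarrier H\<rbrakk> \<Longrightarrow> hinner H u (c *\<^sub>C v) = cnj c * hinner H u v"
  by (subst (1 2) inner_commute) (auto simp: inner_scale_left)

lemma inner_diff_right: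
  assumes "u \<in> hcarrier H" "v \<in> hcarrier H" "v' \<in> hcarrier H"
  shows "hinner H u (v - v') = hinner H u v - hinner H u v'"
  using inner_add_right[of u "v - v'" v'] assms by simp

lemma inner_zero_right [simp]: "v \<in> hcarrier H \<Longrightarrow> hinner H v 0 = 0"
  using inner_diff_right[of v 0 0] by simp

lemma inner_sum_left:
  assumes "\<And>i. i \<in> I \<Longrightarrow> f i \<in> hcarrier H" "v \<in> hcarrier H"
  shows "hinner H (sum f I) v = (\<Sum>i\<in>I. hinner H (f i) v)"
  using assms by (induction I rule: infinite_finite_induct) (auto simp: inner_add_left sum_mem)

lemma inner_sum_right:
  assumes "\<And>i. i \<in> I \<Longrightarrow> f i \<in> hcarrier H" "v \<in> hcarrier H"
  shows "hinner H v (sum f I) = (\<Sum>i\<in>I. hinner H v (f i))"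
  using assms by (induction I rule: infinite_finite_induct) (auto simp: inner_add_right sum_mem)

lemma inner_self_ge_0: "u \<in> hcarrier H \<Longrightarrow> 0 \<le> Re (hinner H u u)"
  using inner_pos[of u] by (cases "u = 0") auto

lemma hnorm_nonneg: "u \<in> hcarrier H \<Longrightarrow> 0 \<le> hnorm H u"
  by (simp add: hnorm_def inner_self_ge_0)

lemma inner_self: "u \<in> hcarrier H \<Longrightarrow> hinner H u u = complex_of_real ((hnorm H u)\<^sup>2)"
  using inner_commute[of u u] inner_self_ge_0[of u] by (simp add: hnorm_def complex_eq_iff)

lemma hnorm_zero: "hnorm H 0 = 0"
  by (simp add: hnorm_def)

lemma hnorm_eq_0_iff [simp]: "u \<in> hcarrier H \<Longrightarrow> hnorm H u = 0 \<longleftrightarrow> u = 0"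
  using inner_pos[of u] by (cases "u = 0") (auto simp: hnorm_def)

lemma hnorm_scale:
  assumes "u \<in> hcarrier H"
  shows "hnorm H (c *\<^sub>C u) = cmod c * hnorm H u"
proof -
  have "hinner H (c *\<^sub>C u) (c *\<^sub>C u) = c * cnj c * hinner H u u"
    using assms inner_scale_left[of u "c *\<^sub>C u" c] inner_scale_right[of u u c]
    by (simp only: scale_mem mult.assoc)
  also have "\<dots> = complex_of_real ((cmod c * hnorm H u)\<^sup>2)"
    using assms by (simp only: inner_self power_mult_distrib of_real_mult complex_norm_square)
  finally have "hinner H (c *\<^sub>C u) (c *\<^sub>C u) = complex_of_real ((cmod c * hnorm H u)\<^sup>2)" .
  then show ?thesis
    using hnorm_nonneg[OF assms] by (simp add: hnorm_def[of _ "c *\<^sub>C u"])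
qed

lemma hnorm_add_sq:
  assumes "u \<in> hcarrier H" "v \<in> hcarrier H"
  shows "(hnorm H (u + v))\<^sup>2 = (hnorm H u)\<^sup>2 + 2 * Re (hinner H u v) + (hnorm H v)\<^sup>2"
proof -
  have "complex_of_real ((hnorm H (u + v))\<^sup>2)
      = of_real ((hnorm H u)\<^sup>2) + (hinner H u v + cnj (hinner H u v)) + of_real ((hnorm H v)\<^sup>2)"
    using assms inner_commute[of v u]
    by (simp add: inner_self[symmetric] inner_add_left inner_add_right del: of_real_power)
  also have "\<dots> = of_real ((hnorm H u)\<^sup>2 + 2 * Re (hinner H u v) + (hnorm H v)\<^sup>2)"
    by (simp add: complex_add_cnj)
  finally show ?thesis using of_real_eq_iff by blast
qed

lemma Cauchy_Schwarz:
  assumes u: "u \<in> hcarrier H" and v: "v \<in> hcarrier H"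
  shows "cmod (hinner H u v) \<le> hnorm H u * hnorm H v"
proof (cases "v = 0")
  case True
  then show ?thesis using u by (simp add: hnorm_zero)
next
  case False
  define a where "a = hinner H u v"
  have nv: "0 < hnorm H v"
    using False v hnorm_nonneg[OF v] by (simp add: less_le)
  \<comment> \<open>With this coefficient u + c v is the component of u orthogonal to v.\<close>
  define c where "c = - (a / of_real ((hnorm H v)\<^sup>2))"
  have "0 \<le> (hnorm H (u + c *\<^sub>C v))\<^sup>2" by simp
  also have "\<dots> = (hnorm H u)\<^sup>2 + 2 * Re (cnj c * a) + (cmod c * hnorm H v)\<^sup>2"
    using u v by (simp add: hnorm_add_sq inner_scale_right hnorm_scale a_def)
  also have "cnj c * a = - of_real ((cmod a)\<^sup>2 / (hnorm H v)\<^sup>2)"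
    by (simp add: c_def complex_norm_square mult.commute del: of_real_power)
  also have "cmod c = cmod a / (hnorm H v)\<^sup>2"
    by (simp add: c_def norm_divide norm_power nv less_imp_le)
  also have "(cmod a / (hnorm H v)\<^sup>2 * hnorm H v)\<^sup>2 = (cmod a)\<^sup>2 / (hnorm H v)\<^sup>2"
    using nv by (simp add: power2_eq_square field_simps)
  finally have "(cmod a)\<^sup>2 \<le> (hnorm H u * hnorm H v)\<^sup>2"
    using nv by (simp add: field_simps power_mult_distrib)
  then show ?thesis
    using hnorm_nonneg[OF u] nv unfolding a_def by (rule_tac power2_le_imp_le) simp_all
qed

lemma hnorm_triangle:
  assumes u: "u \<in> hcarrier H" and v: "v \<in> hcarrier H"
  shows "hnorm H (u + v) \<le> hnorm H u + hnorm H v"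
proof (rule power2_le_imp_le)
  have "Re (hinner H u v) \<le> hnorm H u * hnorm H v"
    using Cauchy_Schwarz[OF u v] complex_Re_le_cmod order_trans by blast
  then show "(hnorm H (u + v))\<^sup>2 \<le> (hnorm H u + hnorm H v)\<^sup>2"
    using u v by (simp add: hnorm_add_sq power2_sum)
qed (use u v hnorm_nonneg in simp)

lemma hnorm_minus_commute:
  assumes "u \<in> hcarrier H" "v \<in> hcarrier H"
  shows "hnorm H (u - v) = hnorm H (v - u)"
proof -
  have "(-1) *\<^sub>C (v - u) = u - v"
    using complex_vector.scale_minus_left[of 1 "v - u"] by (simp add: scaleC_one)
  then show ?thesis using hnorm_scale[of "v - u" "-1"] assms by simp
qed

lemma hdist_eq: "u \<in> hcarrier H \<Longrightarrow> v \<in> hcarrier H \<Longrightarrow> hdist H u v = hnorm H (u - v)"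
  by (simp add: hdist_def)

end

sublocale pre_hilbert \<subseteq> Metric_space "hcarrier H" "hdist H"
proof
  fix x y z
  show "0 \<le> hdist H x y"
    by (simp add: hdist_def hnorm_nonneg)
  show "hdist H x y = hdist H y x"
    by (auto simp: hdist_def hnorm_minus_commute)
  assume x: "x \<in> hcarrier H" and y: "y \<in> hcarrier H"
  show "hdist H x y = 0 \<longleftrightarrow> x = y"
    using x y by (simp add: hdist_eq)
  assume z: "z \<in> hcarrier H"
  show "hdist H x z \<le> hdist H x y + hdist H y z"
    using hnorm_triangle[of "x - y" "y - z"] x y z by (simp add: hdist_eq)
qed

context pre_hilbert
begin

lemma limitin_iff:
  assumes "\<And>n. x n \<in> hcarrier H" "l \<in> hcarrier H"
  shows "limitin mtopology x l sequentially \<longleftrightarrow> (\<lambda>n. hnorm H (x n - l)) \<longlonglongrightarrow> 0"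
  using assms
  by (simp add: limitin_metric_dist_null hdist_eq)

lemma dense_iff:
  assumes "S \<subseteq> hcarrier H"
  shows "mtopology closure_of S = hcarrier H \<longleftrightarrow>
    (\<forall>u\<in>hcarrier H. \<forall>r>0. \<exists>v\<in>S. hnorm H (u - v) < r)"
proof -
  have "v \<in> mball u r \<longleftrightarrow> hnorm H (u - v) < r" if "u \<in> hcarrier H" "v \<in> S" for u v r
    using that assms by (auto simp: in_mball hdist_eq subset_iff)
  then show ?thesis
    unfolding metric_closure_of by blast
qed

lemma dense_superset:
  assumes "mtopology closure_of S = hcarrier H" "S \<subseteq> D" "D \<subseteq> hcarrier H"
  shows "mtopology closure_of D = hcarrier H"
  using assms closure_of_mono[of S D mtopology] closure_of_subset_topspace[of mtopology D] by auto

lemma orthogonal_to_dense_eq_0: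
  assumes S: "S \<subseteq> hcarrier H" "mtopology closure_of S = hcarrier H"
    and w: "w \<in> hcarrier H" and orth: "\<And>v. v \<in> S \<Longrightarrow> hinner H w v = 0"
  shows "w = 0"
proof (rule ccontr)
  assume "w \<noteq> 0"
  then have nw: "0 < hnorm H w"
    using hnorm_nonneg[OF w] w by (simp add: less_le)
  then obtain v where v: "v \<in> S" "hnorm H (w - v) < hnorm H w"
    using S w dense_iff by blast
  then have vH: "v \<in> hcarrier H" using S by auto
  have "(hnorm H w)\<^sup>2 = cmod (hinner H w w)"
    using w by (simp add: inner_self norm_power hnorm_nonneg)
  also have "hinner H w w = hinner H w (w - v)"
    using w vH orth[OF v(1)] by (simp add: inner_diff_right)
  also have "cmod \<dots> \<le> hnorm H w * hnorm H (w - v)"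
    using w vH by (intro Cauchy_Schwarz) auto
  also have "\<dots> < hnorm H w * hnorm H w"
    using nw v by simp
  finally show False by (simp add: power2_eq_square)
qed

text \<open>
  A quadratic form determines its sesquilinear form over the complex numbers: expanding it at
  \<open>u + c v\<close> for \<open>c = 1\<close> and \<open>c = \<i>\<close> isolates the two mixed terms.
\<close>

lemma polarization:
  assumes D: "complex_vector.subspace D" "D \<subseteq> hcarrier H"
    and A: "A \<in> D \<rightarrow> hcarrier H" "linear_on D A" and B: "B \<in> D \<rightarrow> hcarrier H" "linear_on D B"
    and eq: "\<And>u. u \<in> D \<Longrightarrow> hinner H (A u) u = hinner H (B u) u"
    and u: "u \<in> D" and v: "v \<in> D"
  shows "hinner H (A u) v = hinner H (B u) v"
proof -
  define b where "b u v = hinner H (A u) v - hinner H (B u) v" for u v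
  have mem: "w \<in> D \<Longrightarrow> w \<in> hcarrier H \<and> A w \<in> hcarrier H \<and> B w \<in> hcarrier H" for w
    using D A B by auto
  have b0: "b w w = 0" if "w \<in> D" for w
    using eq[OF that] by (simp add: b_def)
  have key: "cnj c * b u v + c * b v u = 0" for c
  proof -
    have cv: "c *\<^sub>C v \<in> D" using D v by (simp add: complex_vector.subspace_scale)
    have s: "u + c *\<^sub>C v \<in> D" using D u cv by (simp add: complex_vector.subspace_add)
    have A': "A (u + c *\<^sub>C v) = A u + c *\<^sub>C A v" and B': "B (u + c *\<^sub>C v) = B u + c *\<^sub>C B v"
      using A B u v cv by (simp_all add: linear_on_def)
    have "b (u + c *\<^sub>C v) (u + c *\<^sub>C v)
        = b u u + cnj c * b u v + c * b v u + c * cnj c * b v v"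
      using mem[OF u] mem[OF v]
      by (simp add: b_def A' B' inner_add_left inner_add_right inner_scale_left
          inner_scale_right algebra_simps)
    then show ?thesis using b0 u v s by simp
  qed
  have "b u v = 0"
    using key[of 1] key[of \<i>] by (simp add: algebra_simps eq_neg_iff_add_eq_0)
  then show ?thesis by (simp add: b_def)
qed

text \<open>
  On a dense subspace the quadratic form fixes the operator, so any operator with the right form is the
  one picked by the definite description.
\<close>

lemma spectral_integral_eqI:
  assumes D: "spectral_integral_dom H E f = D" "complex_vector.subspace D"
      "mtopology closure_of D = hcarrier H"
    and A: "A \<in> D \<rightarrow>\<^sub>E hcarrier H" "linear_on D A"
      "\<And>u. u \<in> D \<Longrightarrow> hinner H (A u) u = complex_of_real (\<integral>t. f t \<partial>scalar_measure H E u)"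
  shows "spectral_integral H E f = A"
  unfolding spectral_integral_def D(1)
proof (rule the_equality)
  show "A \<in> D \<rightarrow>\<^sub>E hcarrier H \<and> linear_on D A \<and>
      (\<forall>u\<in>D. hinner H (A u) u = complex_of_real (\<integral>t. f t \<partial>scalar_measure H E u))"
    using A by blast
next
  fix B
  assume B: "B \<in> D \<rightarrow>\<^sub>E hcarrier H \<and> linear_on D B \<and>
      (\<forall>u\<in>D. hinner H (B u) u = complex_of_real (\<integral>t. f t \<partial>scalar_measure H E u))"
  have DH: "D \<subseteq> hcarrier H" using D(1) by (auto simp: spectral_integral_dom_def)
  have "B u = A u" if u: "u \<in> D" for u
  proof -
    have mem: "A u \<in> hcarrier H" "B u \<in> hcarrier H" using A B u by auto
    have "hinner H (B u) v = hinner H (A u) v" if v: "v \<in> D" for v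
      using polarization[of D B A u v] D DH A B u v by (auto simp: PiE_iff)
    then have "B u - A u = 0"
      using mem DH by (intro orthogonal_to_dense_eq_0[OF DH D(3)]) (auto simp: inner_diff_left subset_iff)
    then show ?thesis by simp
  qed
  then show "B = A"
    using A B by (metis PiE_ext)
qed

end

text \<open>
  The norm of \<open>u + v\<close> gives the real part of the inner product, and replacing \<open>u\<close> by \<open>\<i> u\<close> gives
  the imaginary part.
\<close>

lemma (in pre_hilbert) isometry_preserves_inner:
  assumes K: "pre_hilbert K" and T: "T \<in> hcarrier K \<rightarrow> hcarrier H" "linear_on (hcarrier K) T"
    and iso: "\<And>u. u \<in> hcarrier K \<Longrightarrow> hnorm H (T u) = hnorm K u"
    and u: "u \<in> hcarrier K" and v: "v \<in> hcarrier K"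
  shows "hinner H (T u) (T v) = hinner K u v"
proof -
  interpret K: pre_hilbert K by (rule K)
  have Re_eq: "Re (hinner H (T x) (T v)) = Re (hinner K x v)" if x: "x \<in> hcarrier K" for x
  proof -
    have mem: "T x \<in> hcarrier H" "T v \<in> hcarrier H" using T x v by auto
    have "T (x + v) = T x + T v" using T x v by (simp add: linear_on_def)
    then have "hnorm H (T x + T v) = hnorm K (x + v)" using iso[of "x + v"] x v by simp
    then show ?thesis
      using hnorm_add_sq[OF mem] K.hnorm_add_sq[OF x v] iso[OF x] iso[OF v] by simp
  qed
  have mem: "T u \<in> hcarrier H" "T v \<in> hcarrier H" using T u v by auto
  have "T (\<i> *\<^sub>C u) = \<i> *\<^sub>C T u" using T u by (simp add: linear_on_def)
  then have "Im (hinner H (T u) (T v)) = Im (hinner K u v)"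
    using Re_eq[of "\<i> *\<^sub>C u"] u v mem by (simp add: inner_scale_left K.inner_scale_left)
  then show ?thesis using Re_eq[OF u] by (simp add: complex_eq_iff)
qed

lemma hilbert_space_iff:
  "hilbert_space H \<longleftrightarrow> pre_hilbert H \<and> Metric_space.mcomplete (hcarrier H) (hdist H)"
  unfolding hilbert_space_def pre_hilbert_def Ball_def by iprover

section \<open>Projection-valued measures and spectral integrals\<close>

locale pvm = pre_hilbert H for H :: "'a::complex_vector hspace" +
  fixes E :: "real set \<Rightarrow> 'a \<Rightarrow> 'a"
  assumes complete: "mcomplete"
    and pvm: "projection_valued_measure H E"
begin

lemma proj: "B \<in> sets borel \<Longrightarrow> orthogonal_projection H (E B)"
  using pvm by (auto simp: projection_valued_measure_def PiE_iff)

lemma proj_mem [simp]: "B \<in> sets borel \<Longrightarrow> u \<in> hcarrier H \<Longrightarrow> E B u \<in> hcarrier H"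
  using proj[of B] by (auto simp: orthogonal_projection_def PiE_iff)

lemma proj_linear: "B \<in> sets borel \<Longrightarrow> linear_on (hcarrier H) (E B)"
  using proj[of B] by (simp add: orthogonal_projection_def)

lemma proj_add:
  "\<lbrakk>B \<in> sets borel; u \<in> hcarrier H; v \<in> hcarrier H\<rbrakk> \<Longrightarrow> E B (u + v) = E B u + E B v"
  using proj_linear[of B] by (simp add: linear_on_def)

lemma proj_scale: "\<lbrakk>B \<in> sets borel; u \<in> hcarrier H\<rbrakk> \<Longrightarrow> E B (c *\<^sub>C u) = c *\<^sub>C E B u"
  using proj_linear[of B] by (simp add: linear_on_def)

lemma proj_symmetric:
  "\<lbrakk>B \<in> sets borel; u \<in> hcarrier H; v \<in> hcarrier H\<rbrakk> \<Longrightarrow> hinner H (E B u) v = hinner H u (E B v)"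
  using proj[of B] by (simp add: orthogonal_projection_def)

lemma proj_Int:
  "\<lbrakk>A \<in> sets borel; B \<in> sets borel; u \<in> hcarrier H\<rbrakk> \<Longrightarrow> E A (E B u) = E (A \<inter> B) u"
  using pvm by (simp add: projection_valued_measure_def)

lemma proj_UNIV: "u \<in> hcarrier H \<Longrightarrow> E UNIV u = u"
  using pvm by (simp add: projection_valued_measure_def)

lemma proj_countable_Union:
  "\<lbrakk>range A \<subseteq> sets borel; disjoint_family A; u \<in> hcarrier H\<rbrakk>
    \<Longrightarrow> (\<lambda>n. hnorm H (E (\<Union>i::nat. A i) u - (\<Sum>i<n. E (A i) u))) \<longlonglongrightarrow> 0"
  using pvm by (simp add: projection_valued_measure_def)

lemma inner_proj_proj:
  assumes "A \<in> sets borel" "B \<in> sets borel" "u \<in> hcarrier H" "v \<in> hcarrier H"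
  shows "hinner H (E A u) (E B v) = hinner H (E (A \<inter> B) u) v"
  using assms by (simp add: proj_symmetric[symmetric] proj_Int Int_commute)

lemma inner_proj_self:
  assumes "B \<in> sets borel" "u \<in> hcarrier H"
  shows "hinner H (E B u) u = complex_of_real ((hnorm H (E B u))\<^sup>2)"
  using inner_proj_proj[of B B u u] assms by (simp add: inner_self)

text \<open>Countable additivity in norm, paired with \<open>u\<close>, is countable additivity of \<open>B \<mapsto> (E(B)u, u)\<close>.\<close>

lemma proj_sums:
  assumes A: "range A \<subseteq> sets borel" "disjoint_family (A :: nat \<Rightarrow> real set)" and u: "u \<in> hcarrier H"
  shows "(\<lambda>i. Re (hinner H (E (A i) u) u)) sums Re (hinner H (E (\<Union>i. A i) u) u)"
  unfolding sums_def
proof (rule LIM_zero_cancel, rule Lim_null_comparison)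
  have Ai: "A i \<in> sets borel" for i using A by auto
  have AU: "(\<Union>i. A i) \<in> sets borel" using A by auto
  have S: "(\<Sum>i<n. E (A i) u) \<in> hcarrier H" for n using u Ai by (simp add: sum_mem)
  have "\<bar>(\<Sum>i<n. Re (hinner H (E (A i) u) u)) - Re (hinner H (E (\<Union>i. A i) u) u)\<bar>
      \<le> hnorm H (E (\<Union>i. A i) u - (\<Sum>i<n. E (A i) u)) * hnorm H u" for n
  proof -
    have "(\<Sum>i<n. Re (hinner H (E (A i) u) u)) - Re (hinner H (E (\<Union>i. A i) u) u)
        = - Re (hinner H (E (\<Union>i. A i) u - (\<Sum>i<n. E (A i) u)) u)"
      using u Ai AU S by (simp add: inner_diff_left inner_sum_left)
    also have "\<bar>\<dots>\<bar> \<le> cmod (hinner H (E (\<Union>i. A i) u - (\<Sum>i<n. E (A i) u)) u)"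
      using abs_Re_le_cmod by simp
    also have "\<dots> \<le> hnorm H (E (\<Union>i. A i) u - (\<Sum>i<n. E (A i) u)) * hnorm H u"
      using u AU S by (intro Cauchy_Schwarz) auto
    finally show ?thesis .
  qed
  then show "\<forall>\<^sub>F n in sequentially.
      norm ((\<Sum>i<n. Re (hinner H (E (A i) u) u)) - Re (hinner H (E (\<Union>i. A i) u) u))
      \<le> hnorm H (E (\<Union>i. A i) u - (\<Sum>i<n. E (A i) u)) * hnorm H u"
    by (simp add: always_eventually)
  show "(\<lambda>n. hnorm H (E (\<Union>i. A i) u - (\<Sum>i<n. E (A i) u)) * hnorm H u) \<longlonglongrightarrow> 0"
    using tendsto_mult[OF proj_countable_Union[OF A u] tendsto_const[of "hnorm H u"]] by simp
qed

lemma proj_empty: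
  assumes u: "u \<in> hcarrier H"
  shows "E {} u = 0"
proof -
  have "(\<lambda>i::nat. Re (hinner H (E {} u) u)) sums Re (hinner H (E {} u) u)"
    using proj_sums[of "\<lambda>_. {}" u] u by (simp add: disjoint_family_on_def)
  then have "Re (hinner H (E {} u) u) = 0"
    by (auto dest!: sums_summable summable_LIMSEQ_zero simp: LIMSEQ_const_iff)
  then show ?thesis using u by (simp add: inner_proj_self del: of_real_power)
qed

lemma
  shows space_scalar_measure [simp]: "space (scalar_measure H E u) = UNIV"
    and sets_scalar_measure [simp, measurable_cong]: "sets (scalar_measure H E u) = sets borel"
  unfolding scalar_measure_def
  using sets.sigma_sets_eq[of "borel :: real measure"] by simp_all

lemma emeasure_scalar_measure:
  assumes u: "u \<in> hcarrier H" and B: "B \<in> sets borel"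
  shows "emeasure (scalar_measure H E u) B = ennreal ((hnorm H (E B u))\<^sup>2)"
proof -
  let ?\<mu> = "\<lambda>B. ennreal (Re (hinner H (E B u) u))"
  have "emeasure (scalar_measure H E u) B = ?\<mu> B"
  proof (rule emeasure_measure_of[OF scalar_measure_def])
    show "sets (borel :: real measure) \<subseteq> Pow UNIV" by simp
    show "positive (sets (scalar_measure H E u)) ?\<mu>"
      using u by (simp add: positive_def proj_empty)
    show "countably_additive (sets (scalar_measure H E u)) ?\<mu>"
    proof (rule countably_additiveI)
      fix A :: "nat \<Rightarrow> real set"
      assume A: "range A \<subseteq> sets (scalar_measure H E u)" "disjoint_family A"
      then have "0 \<le> Re (hinner H (E (A i) u) u)" for i
        using u by (auto simp: inner_proj_self image_subset_iff)
      then show "(\<Sum>i. ?\<mu> (A i)) = ?\<mu> (\<Union> (range A))"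
        using proj_sums[of A u] A u by (intro suminf_ennreal_eq) simp_all
    qed
    show "B \<in> sets (scalar_measure H E u)" using B by simp
  qed
  then show ?thesis using u B by (simp add: inner_proj_self)
qed

lemma finite_scalar_measure: "u \<in> hcarrier H \<Longrightarrow> finite_measure (scalar_measure H E u)"
  by (rule finite_measureI) (simp add: emeasure_scalar_measure)

lemma measure_scalar_measure:
  "u \<in> hcarrier H \<Longrightarrow> B \<in> sets borel \<Longrightarrow> measure (scalar_measure H E u) B = (hnorm H (E B u))\<^sup>2"
  by (simp add: measure_def emeasure_scalar_measure)

text \<open>
  Projections onto disjoint sets have orthogonal ranges, so this is the theorem of Pythagoras.
\<close>

lemma hnorm_sum_proj_sq:
  assumes I: "finite I" and P: "\<And>p. p \<in> I \<Longrightarrow> P p \<in> sets borel" "disjoint_family_on P I"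
    and u: "u \<in> hcarrier H"
  shows "(hnorm H (\<Sum>p\<in>I. complex_of_real (c p) *\<^sub>C E (P p) u))\<^sup>2
      = (\<Sum>p\<in>I. (c p)\<^sup>2 * (hnorm H (E (P p) u))\<^sup>2)"
proof -
  let ?s = "\<Sum>p\<in>I. complex_of_real (c p) *\<^sub>C E (P p) u"
  have s: "?s \<in> hcarrier H" using P u by (simp add: sum_mem)
  have row: "hinner H (of_real (c p) *\<^sub>C E (P p) u) ?s
      = of_real ((c p)\<^sup>2 * (hnorm H (E (P p) u))\<^sup>2)" if p: "p \<in> I" for p
  proof -
    have orth: "hinner H (E (P p) u) (E (P q) u) = (if q = p then of_real ((hnorm H (E (P p) u))\<^sup>2) else 0)"
      if q: "q \<in> I" for q
      using P p q u by (auto simp: inner_proj_proj inner_proj_self disjoint_family_on_def proj_empty)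
    have "hinner H (of_real (c p) *\<^sub>C E (P p) u) ?s
        = (\<Sum>q\<in>I. of_real (c p) * of_real (c q) * hinner H (E (P p) u) (E (P q) u))"
      using P p u s
      by (simp add: inner_sum_right inner_scale_left inner_scale_right sum_distrib_left mult_ac)
    also have "\<dots> = (\<Sum>q\<in>I. if q = p then of_real (c p) * of_real (c p) * of_real ((hnorm H (E (P p) u))\<^sup>2) else 0)"
      by (intro sum.cong refl) (simp add: orth)
    also have "\<dots> = of_real ((c p)\<^sup>2 * (hnorm H (E (P p) u))\<^sup>2)"
      using I p by (simp add: power2_eq_square)
    finally show ?thesis .
  qed
  have "of_real ((hnorm H ?s)\<^sup>2) = hinner H ?s ?s" using s by (simp add: inner_self)
  also have "\<dots> = (\<Sum>p\<in>I. hinner H (of_real (c p) *\<^sub>C E (P p) u) ?s)"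
    using P u s by (intro inner_sum_left) auto
  also have "\<dots> = of_real (\<Sum>p\<in>I. (c p)\<^sup>2 * (hnorm H (E (P p) u))\<^sup>2)"
    by (simp add: row del: of_real_mult of_real_power)
  finally show ?thesis using of_real_eq_iff by blast
qed

text \<open>
  Finite additivity, deduced from the additivity of the scalar measure: the squared norms of both sides
  and their inner product all equal \<open>\<Sum>\<parallel>E(P)u\<parallel>\<^sup>2\<close>, so their difference has norm 0.
\<close>

lemma proj_sum_partition:
  assumes I: "finite I" and P: "\<And>p. p \<in> I \<Longrightarrow> P p \<in> sets borel" "disjoint_family_on P I"
    and u: "u \<in> hcarrier H"
  shows "E (\<Union>p\<in>I. P p) u = (\<Sum>p\<in>I. E (P p) u)"
proof -
  let ?U = "\<Union>p\<in>I. P p" and ?s = "\<Sum>p\<in>I. E (P p) u"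
  have U: "?U \<in> sets borel" using I P by auto
  have s: "?s \<in> hcarrier H" using P u by (simp add: sum_mem)
  interpret finite_measure "scalar_measure H E u" by (rule finite_scalar_measure[OF u])
  have eq: "(hnorm H (E ?U u))\<^sup>2 = (\<Sum>p\<in>I. (hnorm H (E (P p) u))\<^sup>2)"
    using I P U u finite_measure_finite_Union[of I P]
    by (simp add: measure_scalar_measure image_subset_iff)
  have "hinner H (E ?U u) ?s = (\<Sum>p\<in>I. hinner H (E ?U u) (E (P p) u))"
    using P u U by (intro inner_sum_right) auto
  also have "\<dots> = (\<Sum>p\<in>I. of_real ((hnorm H (E (P p) u))\<^sup>2))"
  proof (intro sum.cong refl)
    fix p assume p: "p \<in> I"
    then have "?U \<inter> P p = P p" by auto
    then show "hinner H (E ?U u) (E (P p) u) = of_real ((hnorm H (E (P p) u))\<^sup>2)"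
      using p P U u by (simp add: inner_proj_proj inner_proj_self)
  qed
  finally have mixed: "Re (hinner H (E ?U u) ?s) = (\<Sum>p\<in>I. (hnorm H (E (P p) u))\<^sup>2)"
    by simp
  have ns: "(hnorm H ?s)\<^sup>2 = (\<Sum>p\<in>I. (hnorm H (E (P p) u))\<^sup>2)"
    using hnorm_sum_proj_sq[OF I P u, of "\<lambda>_. 1"] by (simp add: scaleC_one)
  have "(hnorm H (E ?U u + (-1) *\<^sub>C ?s))\<^sup>2
      = (hnorm H (E ?U u))\<^sup>2 + 2 * Re (hinner H (E ?U u) ((-1) *\<^sub>C ?s)) + (hnorm H ((-1) *\<^sub>C ?s))\<^sup>2"
    using U u s by (intro hnorm_add_sq scale_mem proj_mem)
  also have "\<dots> = 0"
    using U u s eq mixed ns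
    by (simp add: inner_scale_right hnorm_scale del: complex_vector.scale_minus_left)
  finally have "(hnorm H (E ?U u + (-1) *\<^sub>C ?s))\<^sup>2 = 0" .
  moreover have "(-1) *\<^sub>C ?s = - ?s"
    using complex_vector.scale_minus_left[of 1 ?s] by (simp only: scaleC_one)
  ultimately show ?thesis using U u s by simp
qed

definition simple_integral :: "(real \<Rightarrow> real) \<Rightarrow> 'a \<Rightarrow> 'a"
  where "simple_integral g u = (\<Sum>y\<in>range g. complex_of_real y *\<^sub>C E (g -` {y}) u)"

lemma simple_level_set:
  assumes "simple_function borel g"
  shows "finite (range g)" "g -` {y} \<in> sets borel"
  using assms simple_functionD[of borel g] by auto

lemma simple_integral_mem:
  "simple_function borel g \<Longrightarrow> u \<in> hcarrier H \<Longrightarrow> simple_integral g u \<in> hcarrier H"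
  by (simp add: simple_integral_def sum_mem simple_level_set)

lemma simple_integral_add:
  assumes "simple_function borel g" "u \<in> hcarrier H" "v \<in> hcarrier H"
  shows "simple_integral g (u + v) = simple_integral g u + simple_integral g v"
  using assms
  by (simp add: simple_integral_def proj_add simple_level_set scaleC_add_right sum.distrib)

lemma simple_integral_scale:
  assumes "simple_function borel g" "u \<in> hcarrier H"
  shows "simple_integral g (c *\<^sub>C u) = c *\<^sub>C simple_integral g u"
  using assms
  by (simp add: simple_integral_def proj_scale simple_level_set complex_vector.scale_sum_right
      scaleC_scaleC mult.commute)

lemma integral_finite_partition:
  assumes u: "u \<in> hcarrier H" and I: "finite I"
    and P: "\<And>p. p \<in> I \<Longrightarrow> P p \<in> sets borel" "disjoint_family_on P I" "(\<Union>p\<in>I. P p) = UNIV"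
    and h: "\<And>p t. p \<in> I \<Longrightarrow> t \<in> P p \<Longrightarrow> h t = c p"
  shows "(\<integral>t. h t \<partial>scalar_measure H E u) = (\<Sum>p\<in>I. c p * (hnorm H (E (P p) u))\<^sup>2)"
proof -
  interpret finite_measure "scalar_measure H E u" by (rule finite_scalar_measure[OF u])
  have eq: "h t = (\<Sum>p\<in>I. c p * indicator (P p) t)" for t
  proof -
    obtain p where p: "p \<in> I" "t \<in> P p" using P(3) by blast
    have "(\<Sum>q\<in>I. c q * indicator (P q) t) = (\<Sum>q\<in>I. if q = p then c p else 0)"
      using P(2) p by (intro sum.cong refl) (auto simp: disjoint_family_on_def indicator_def)
    then show ?thesis using I p h by simp
  qed
  have int: "integrable (scalar_measure H E u) (\<lambda>t. c p * indicator (P p) t)" if "p \<in> I" for p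
    using P that by (intro integrable_mult_right) (simp add: integrable_indicator_iff less_top emeasure_eq_measure)
  have heq: "h = (\<lambda>t. \<Sum>p\<in>I. c p * indicator (P p) t)"
    using eq by (rule ext)
  show "(\<integral>t. h t \<partial>scalar_measure H E u) = (\<Sum>p\<in>I. c p * (hnorm H (E (P p) u))\<^sup>2)"
    unfolding heq using int P u
    by (simp add: Bochner_Integration.integral_sum measure_scalar_measure)
qed

text \<open>The map \<open>g \<mapsto> simple_integral g u\<close> is an isometry from \<open>L\<^sup>2\<close> of the scalar measure of \<open>u\<close>. The
  two functions are compared on the common refinement of their level sets.\<close>

lemma simple_integral_isometry:
  assumes g: "simple_function borel g" and g': "simple_function borel g'" and u: "u \<in> hcarrier H"
  shows "(hnorm H (simple_integral g u - simple_integral g' u))\<^sup>2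
      = (\<integral>t. (g t - g' t)\<^sup>2 \<partial>scalar_measure H E u)"
proof -
  let ?I = "range g \<times> range g'"
  define P where "P = (\<lambda>(y, y'). g -` {y} \<inter> g' -` {y'})"
  have I: "finite ?I" using g g' by (simp add: simple_level_set)
  have P: "P p \<in> sets borel" for p
    using g g' by (auto simp: P_def simple_level_set split: prod.split)
  have disj: "disjoint_family_on P ?I" "(\<Union>p\<in>?I. P p) = UNIV"
    by (auto simp: P_def disjoint_family_on_def)
  have 1: "E (g -` {y}) u = (\<Sum>y'\<in>range g'. E (P (y, y')) u)" for y
  proof -
    have "g -` {y} = (\<Union>y'\<in>range g'. P (y, y'))" by (auto simp: P_def)
    moreover have "disjoint_family_on (\<lambda>y'. P (y, y')) (range g')"
      by (auto simp: P_def disjoint_family_on_def)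
    ultimately show ?thesis
      using proj_sum_partition[of "range g'" "\<lambda>y'. P (y, y')" u] P u g' by (simp add: simple_level_set)
  qed
  have 2: "E (g' -` {y'}) u = (\<Sum>y\<in>range g. E (P (y, y')) u)" for y'
  proof -
    have "g' -` {y'} = (\<Union>y\<in>range g. P (y, y'))" by (auto simp: P_def)
    moreover have "disjoint_family_on (\<lambda>y. P (y, y')) (range g)"
      by (auto simp: P_def disjoint_family_on_def)
    ultimately show ?thesis
      using proj_sum_partition[of "range g" "\<lambda>y. P (y, y')" u] P u g by (simp add: simple_level_set)
  qed
  have "simple_integral g u = (\<Sum>y\<in>range g. \<Sum>y'\<in>range g'. complex_of_real y *\<^sub>C E (P (y, y')) u)"
    by (simp add: simple_integral_def 1 complex_vector.scale_sum_right)
  also have "\<dots> = (\<Sum>p\<in>?I. complex_of_real (fst p) *\<^sub>C E (P p) u)"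
    by (simp add: sum.cartesian_product case_prod_beta)
  finally have s1: "simple_integral g u = (\<Sum>p\<in>?I. complex_of_real (fst p) *\<^sub>C E (P p) u)" .
  have "simple_integral g' u = (\<Sum>y'\<in>range g'. \<Sum>y\<in>range g. complex_of_real y' *\<^sub>C E (P (y, y')) u)"
    by (simp add: simple_integral_def 2 complex_vector.scale_sum_right)
  also have "\<dots> = (\<Sum>y\<in>range g. \<Sum>y'\<in>range g'. complex_of_real y' *\<^sub>C E (P (y, y')) u)"
    by (rule sum.swap)
  also have "\<dots> = (\<Sum>p\<in>?I. complex_of_real (snd p) *\<^sub>C E (P p) u)"
    by (simp add: sum.cartesian_product case_prod_beta)
  finally have s2: "simple_integral g' u = (\<Sum>p\<in>?I. complex_of_real (snd p) *\<^sub>C E (P p) u)" .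
  have "simple_integral g u - simple_integral g' u
      = (\<Sum>p\<in>?I. complex_of_real (fst p - snd p) *\<^sub>C E (P p) u)"
    by (simp add: s1 s2 sum_subtractf complex_vector.scale_left_diff_distrib)
  moreover have "(\<integral>t. (g t - g' t)\<^sup>2 \<partial>scalar_measure H E u)
      = (\<Sum>p\<in>?I. (fst p - snd p)\<^sup>2 * (hnorm H (E (P p) u))\<^sup>2)"
    by (rule integral_finite_partition[OF u I P disj]) (auto simp: P_def)
  ultimately show ?thesis
    using hnorm_sum_proj_sq[OF I P disj(1) u, of "\<lambda>p. fst p - snd p"] by simp
qed

lemma simple_integral_norm:
  assumes g: "simple_function borel g" and u: "u \<in> hcarrier H"
  shows "(hnorm H (simple_integral g u))\<^sup>2 = (\<integral>t. (g t)\<^sup>2 \<partial>scalar_measure H E u)"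
proof -
  have "range (\<lambda>_::real. 0::real) = {0}" by auto
  then have "simple_integral (\<lambda>_. 0) u = 0" by (simp add: simple_integral_def)
  then show ?thesis
    using simple_integral_isometry[OF g _ u, of "\<lambda>_. 0"] by simp
qed

lemma simple_integral_inner:
  assumes g: "simple_function borel g" and u: "u \<in> hcarrier H"
  shows "hinner H (simple_integral g u) u = complex_of_real (\<integral>t. g t \<partial>scalar_measure H E u)"
proof -
  have "(\<integral>t. g t \<partial>scalar_measure H E u) = (\<Sum>y\<in>range g. y * (hnorm H (E (g -` {y}) u))\<^sup>2)"
    by (rule integral_finite_partition[OF u])
      (use g in \<open>auto simp: simple_level_set disjoint_family_on_def\<close>)
  moreover have "hinner H (simple_integral g u) u
      = (\<Sum>y\<in>range g. complex_of_real y * hinner H (E (g -` {y}) u) u)"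
    unfolding simple_integral_def using g u
    by (subst inner_sum_left) (simp_all add: simple_level_set inner_scale_left)
  ultimately show ?thesis using g u by (simp add: inner_proj_self simple_level_set)
qed

text \<open>
  On the domain of \<open>\<integral> f dE\<close> the integrals of simple functions approximating \<open>f\<close> converge by the
  isometry. The limit depends linearly on \<open>u\<close> and inherits the form \<open>\<integral> f d(Eu, u)\<close> and the squared norm
  \<open>\<integral> f\<^sup>2 d(Eu, u)\<close>; by uniqueness it is the spectral integral.
\<close>

lemma spectral_integral_properties:
  assumes f: "f \<in> borel_measurable borel"
    and D: "spectral_integral_dom H E f = D" "complex_vector.subspace D"
      "mtopology closure_of D = hcarrier H"
    and u: "u \<in> D"
  shows "spectral_integral H E f u \<in> hcarrier H"
    and "hinner H (spectral_integral H E f u) u = complex_of_real (\<integral>t. f t \<partial>scalar_measure H E u)"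
    and "(hnorm H (spectral_integral H E f u))\<^sup>2 = (\<integral>t. (f t)\<^sup>2 \<partial>scalar_measure H E u)"
proof -
  obtain F where F: "\<And>n. simple_function borel (F n)" "\<And>x. (\<lambda>n. F n x) \<longlonglongrightarrow> f x"
      "\<And>n x. \<bar>F n x\<bar> \<le> 2 * \<bar>f x\<bar>"
    using borel_measurable_implies_sequence_metric[OF f, of 0] by (auto simp: dist_real_def)
  have F_borel [measurable]: "F n \<in> borel_measurable borel" for n
    using F(1) by (rule borel_measurable_simple_function)
  note f [measurable]
  define S where "S n v = simple_integral (F n) v" for n v
  have DH: "v \<in> D \<Longrightarrow> v \<in> hcarrier H" for v
    using D(1) by (auto simp: spectral_integral_dom_def)
  have S_mem: "S n v \<in> hcarrier H" if "v \<in> D" for n v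
    using DH[OF that] F(1) by (simp add: S_def simple_integral_mem)
  have f2: "integrable (scalar_measure H E v) (\<lambda>t. (f t)\<^sup>2)" if "v \<in> D" for v
    using that D(1) by (auto simp: spectral_integral_dom_def)
  have f1: "integrable (scalar_measure H E v) f" if v: "v \<in> D" for v
  proof -
    interpret finite_measure "scalar_measure H E v" by (rule finite_scalar_measure[OF DH[OF v]])
    show ?thesis
    proof (rule Bochner_Integration.integrable_bound)
      show "integrable (scalar_measure H E v) (\<lambda>t. 1 + (f t)\<^sup>2)"
        using f2[OF v] by simp
      show "AE t in scalar_measure H E v. norm (f t) \<le> norm (1 + (f t)\<^sup>2)"
      proof (rule AE_I2)
        fix t
        have "0 \<le> (\<bar>f t\<bar> - 1)\<^sup>2" by simp
        then show "norm (f t) \<le> norm (1 + (f t)\<^sup>2)"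
          by (simp add: power2_diff)
      qed
    qed simp
  qed
  define conv where "conv v l \<longleftrightarrow> l \<in> hcarrier H \<and> (\<lambda>n. hnorm H (S n v - l)) \<longlonglongrightarrow> 0" for v l
  have ex: "\<exists>l. conv v l" if v: "v \<in> D" for v
  proof -
    let ?\<mu> = "scalar_measure H E v"
    interpret finite_measure ?\<mu> by (rule finite_scalar_measure[OF DH[OF v]])
    have bound: "(F n t - f t)\<^sup>2 \<le> 9 * (f t)\<^sup>2" for n t
    proof -
      have "\<bar>F n t - f t\<bar> \<le> 3 * \<bar>f t\<bar>" using F(3)[of n t] by linarith
      then have "\<bar>F n t - f t\<bar>\<^sup>2 \<le> (3 * \<bar>f t\<bar>)\<^sup>2" by (intro power_mono) auto
      then show ?thesis by (simp add: power_mult_distrib)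
    qed
    have int: "integrable ?\<mu> (\<lambda>t. (F n t - f t)\<^sup>2)" for n
      by (rule Bochner_Integration.integrable_bound[where f = "\<lambda>t. 9 * (f t)\<^sup>2"])
        (use f2[OF v] bound in \<open>auto simp: abs_if\<close>)
    define d where "d n = (\<integral>t. (F n t - f t)\<^sup>2 \<partial>?\<mu>)" for n
    have "d \<longlonglongrightarrow> (\<integral>t. 0 \<partial>?\<mu>)"
      unfolding d_def
    proof (rule integral_dominated_convergence[where w = "\<lambda>t. 9 * (f t)\<^sup>2"])
      show "AE t in ?\<mu>. (\<lambda>n. (F n t - f t)\<^sup>2) \<longlonglongrightarrow> 0"
        using tendsto_power[OF LIM_zero[OF F(2)], of _ 2] by simp
    qed (use f2[OF v] bound in auto)
    then have d0: "d \<longlonglongrightarrow> 0" by simp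
    have dist_le: "(hnorm H (S n v - S m v))\<^sup>2 \<le> 2 * d n + 2 * d m" for n m
    proof -
      have "(hnorm H (S n v - S m v))\<^sup>2 = (\<integral>t. (F n t - F m t)\<^sup>2 \<partial>?\<mu>)"
        unfolding S_def by (rule simple_integral_isometry[OF F(1) F(1) DH[OF v]])
      also have "\<dots> \<le> (\<integral>t. 2 * (F n t - f t)\<^sup>2 + 2 * (F m t - f t)\<^sup>2 \<partial>?\<mu>)"
      proof (rule Bochner_Integration.integral_mono')
        show "integrable ?\<mu> (\<lambda>t. 2 * (F n t - f t)\<^sup>2 + 2 * (F m t - f t)\<^sup>2)"
          using int by auto
        fix t
        show "(F n t - F m t)\<^sup>2 \<le> 2 * (F n t - f t)\<^sup>2 + 2 * (F m t - f t)\<^sup>2"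
          using zero_le_power2[of "(F n t - f t) + (F m t - f t)"]
          by (simp add: power2_eq_square algebra_simps)
      qed auto
      also have "\<dots> = 2 * d n + 2 * d m" using int by (simp add: d_def)
      finally show ?thesis .
    qed
    have "MCauchy (\<lambda>n. S n v)"
      unfolding MCauchy_def
    proof (intro conjI allI impI)
      show "range (\<lambda>n. S n v) \<subseteq> hcarrier H" using S_mem[OF v] by auto
      fix \<epsilon> :: real assume \<epsilon>: "0 < \<epsilon>"
      then have "\<forall>\<^sub>F n in sequentially. d n < \<epsilon>\<^sup>2 / 4"
        using d0 by (intro order_tendstoD(2)) auto
      then obtain N where N: "\<And>n. N \<le> n \<Longrightarrow> d n < \<epsilon>\<^sup>2 / 4"
        by (auto simp: eventually_sequentially)
      have "hdist H (S n v) (S m v) < \<epsilon>" if "N \<le> n" "N \<le> m" for n m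
      proof -
        have "(hnorm H (S n v - S m v))\<^sup>2 < \<epsilon>\<^sup>2"
          using dist_le[of n m] N[OF that(1)] N[OF that(2)] by linarith
        then have "hnorm H (S n v - S m v) < \<epsilon>"
          by (rule power2_less_imp_less) (use \<epsilon> in simp)
        then show ?thesis using S_mem[OF v] by (simp add: hdist_eq)
      qed
      then show "\<exists>N. \<forall>n m. N \<le> n \<longrightarrow> N \<le> m \<longrightarrow> hdist H (S n v) (S m v) < \<epsilon>" by blast
    qed
    then obtain l where l: "limitin mtopology (\<lambda>n. S n v) l sequentially"
      using complete by (auto simp: mcomplete_def)
    moreover have "l \<in> hcarrier H" using limitin_mspace[OF l] .
    ultimately show ?thesis
      using S_mem[OF v] by (auto simp: conv_def limitin_iff)
  qed
  have unique: "l = l'" if v: "v \<in> D" and l: "conv v l" "conv v l'" for v l l'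
  proof -
    have "limitin mtopology (\<lambda>n. S n v) l sequentially" "limitin mtopology (\<lambda>n. S n v) l' sequentially"
      using l S_mem[OF v] by (simp_all add: conv_def limitin_iff)
    then show ?thesis
      using limitin_metric_unique by (metis trivial_limit_sequentially)
  qed
  define A where "A = (\<lambda>v\<in>D. SOME l. conv v l)"
  have A: "conv v (A v)" if "v \<in> D" for v
    using someI_ex[OF ex[OF that]] that by (simp add: A_def)
  have A_mem: "A v \<in> hcarrier H" if "v \<in> D" for v
    using A[OF that] by (simp add: conv_def)
  have A_lim: "(\<lambda>n. hnorm H (S n v - A v)) \<longlonglongrightarrow> 0" if "v \<in> D" for v
    using A[OF that] by (simp add: conv_def)
  have A_lin: "linear_on D A"
    unfolding linear_on_def
  proof (intro conjI ballI allI)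
    fix v w assume v: "v \<in> D" and w: "w \<in> D"
    have vw: "v + w \<in> D" using D(2) v w by (rule complex_vector.subspace_add)
    have "conv (v + w) (A v + A w)"
      unfolding conv_def
    proof (intro conjI)
      show "A v + A w \<in> hcarrier H" using A_mem v w by simp
      have bound: "hnorm H (S n (v + w) - (A v + A w)) \<le> hnorm H (S n v - A v) + hnorm H (S n w - A w)" for n
      proof -
        have eq: "S n (v + w) - (A v + A w) = (S n v - A v) + (S n w - A w)"
          using DH v w F(1) by (simp add: S_def simple_integral_add)
        show ?thesis
          unfolding eq by (rule hnorm_triangle[OF diff_mem diff_mem]) (simp_all add: A_mem S_mem v w)
      qed
      have nonneg: "0 \<le> hnorm H (S n (v + w) - (A v + A w))" for n
        by (intro hnorm_nonneg diff_mem add_mem S_mem A_mem v w vw)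
      have "(\<lambda>n. hnorm H (S n v - A v) + hnorm H (S n w - A w)) \<longlonglongrightarrow> 0"
        by (intro tendsto_add_zero A_lim v w)
      then show "(\<lambda>n. hnorm H (S n (v + w) - (A v + A w))) \<longlonglongrightarrow> 0"
        by (rule Lim_null_comparison[rotated]) (simp only: real_norm_def abs_of_nonneg[OF nonneg] bound eventually_True)
    qed
    then show "A (v + w) = A v + A w" using unique[OF vw A[OF vw]] by blast
  next
    fix c v assume v: "v \<in> D"
    have cv: "c *\<^sub>C v \<in> D" using D(2) v by (rule complex_vector.subspace_scale)
    have "S n (c *\<^sub>C v) - c *\<^sub>C A v = c *\<^sub>C (S n v - A v)" for n
      using DH v F(1) by (simp add: S_def simple_integral_scale complex_vector.scale_right_diff_distrib)
    then have "hnorm H (S n (c *\<^sub>C v) - c *\<^sub>C A v) = cmod c * hnorm H (S n v - A v)" for n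
      using A_mem S_mem v by (simp add: hnorm_scale)
    moreover have "(\<lambda>n. cmod c * hnorm H (S n v - A v)) \<longlonglongrightarrow> 0"
      by (intro tendsto_mult_right_zero A_lim v)
    ultimately have "conv (c *\<^sub>C v) (c *\<^sub>C A v)"
      using A_mem v by (simp add: conv_def)
    then show "A (c *\<^sub>C v) = c *\<^sub>C A v" using unique[OF cv A[OF cv]] by blast
  qed
  have A_inner: "hinner H (A v) v = complex_of_real (\<integral>t. f t \<partial>scalar_measure H E v)" if v: "v \<in> D" for v
  proof (rule LIMSEQ_unique)
    have "(\<lambda>n. \<integral>t. F n t \<partial>scalar_measure H E v) \<longlonglongrightarrow> (\<integral>t. f t \<partial>scalar_measure H E v)"
      by (rule integral_dominated_convergence[where w = "\<lambda>t. 2 * \<bar>f t\<bar>"]) (use f1[OF v] F in auto)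
    then show "(\<lambda>n. hinner H (S n v) v) \<longlonglongrightarrow> complex_of_real (\<integral>t. f t \<partial>scalar_measure H E v)"
      using F(1) DH[OF v] by (simp add: S_def simple_integral_inner tendsto_of_real)
    have bound: "cmod (hinner H (S n v) v - hinner H (A v) v) \<le> hnorm H (S n v - A v) * hnorm H v" for n
      using Cauchy_Schwarz[of "S n v - A v" v] A_mem S_mem DH v by (simp add: inner_diff_left)
    have lim: "(\<lambda>n. hnorm H (S n v - A v) * hnorm H v) \<longlonglongrightarrow> 0"
      by (intro tendsto_mult_left_zero A_lim v)
    show "(\<lambda>n. hinner H (S n v) v) \<longlonglongrightarrow> hinner H (A v) v"
      by (rule LIM_zero_cancel, rule Lim_null_comparison[OF _ lim]) (simp only: bound eventually_True)
  qed
  have A_norm: "(hnorm H (A v))\<^sup>2 = (\<integral>t. (f t)\<^sup>2 \<partial>scalar_measure H E v)" if v: "v \<in> D" for v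
  proof (rule LIMSEQ_unique)
    have "(\<lambda>n. \<integral>t. (F n t)\<^sup>2 \<partial>scalar_measure H E v) \<longlonglongrightarrow> (\<integral>t. (f t)\<^sup>2 \<partial>scalar_measure H E v)"
    proof (rule integral_dominated_convergence[where w = "\<lambda>t. 4 * (f t)\<^sup>2"])
      show "AE t in scalar_measure H E v. (\<lambda>n. (F n t)\<^sup>2) \<longlonglongrightarrow> (f t)\<^sup>2"
        by (rule AE_I2) (rule tendsto_power[OF F(2)])
      have "(F n t)\<^sup>2 \<le> 4 * (f t)\<^sup>2" for n t
        using power_mono[OF F(3)[of n t], of 2] by (simp add: power_mult_distrib)
      then show "AE t in scalar_measure H E v. norm ((F n t)\<^sup>2) \<le> 4 * (f t)\<^sup>2" for n by simp
    qed (use f2[OF v] in auto)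
    then show "(\<lambda>n. (hnorm H (S n v))\<^sup>2) \<longlonglongrightarrow> (\<integral>t. (f t)\<^sup>2 \<partial>scalar_measure H E v)"
      using F(1) DH[OF v] by (simp add: S_def simple_integral_norm)
    have bound: "\<bar>hnorm H (S n v) - hnorm H (A v)\<bar> \<le> hnorm H (S n v - A v)" for n
      using hnorm_triangle[of "S n v - A v" "A v"] hnorm_triangle[of "A v - S n v" "S n v"]
        hnorm_minus_commute[of "S n v" "A v"] A_mem S_mem v by simp
    have "(\<lambda>n. hnorm H (S n v)) \<longlonglongrightarrow> hnorm H (A v)"
      by (rule LIM_zero_cancel, rule Lim_null_comparison[OF _ A_lim[OF v]])
        (simp only: real_norm_def bound eventually_True)
    then show "(\<lambda>n. (hnorm H (S n v))\<^sup>2) \<longlonglongrightarrow> (hnorm H (A v))\<^sup>2"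
      by (rule tendsto_power)
  qed
  have "spectral_integral H E f = A"
  proof (rule spectral_integral_eqI[OF D])
    show "A \<in> D \<rightarrow>\<^sub>E hcarrier H" using A_mem by (auto simp: A_def)
  qed (use A_lin A_inner in auto)
  then show "spectral_integral H E f u \<in> hcarrier H"
    and "hinner H (spectral_integral H E f u) u = complex_of_real (\<integral>t. f t \<partial>scalar_measure H E u)"
    and "(hnorm H (spectral_integral H E f u))\<^sup>2 = (\<integral>t. (f t)\<^sup>2 \<partial>scalar_measure H E u)"
    using u A_mem A_inner A_norm by auto
qed

end

section \<open>Weighted square summable functions\<close>

definition weighted_l2 :: "('i \<Rightarrow> real) \<Rightarrow> ('i \<Rightarrow> complex) hspace"
  where "weighted_l2 w =
    \<lparr>hcarrier = {u. (\<lambda>k. complex_of_real (w k) * u k) \<in> ell2},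
     hinner = (\<lambda>u v. \<Sum>\<^sub>\<infinity>k. (complex_of_real (w k))\<^sup>2 * u k * cnj (v k))\<rparr>"

lemma summable_on_real_iff_integrable:
  fixes f :: "'i \<Rightarrow> real"
  shows "f summable_on UNIV \<longleftrightarrow> integrable (count_space UNIV) f"
  using abs_summable_equivalent[of f UNIV] summable_on_iff_abs_summable_on_real[of f UNIV]
  by (simp add: abs_summable_on_def)

lemma infsum_eq_integral:
  fixes f :: "'i \<Rightarrow> complex"
  assumes "integrable (count_space UNIV) f"
  shows "infsum f UNIV = (\<integral>k. f k \<partial>count_space UNIV)"
  using infsetsum_infsum[of f UNIV] assms by (simp add: abs_summable_on_def infsetsum_def)

lemma minus_fun_apply [simp]: "(f - g) x = f x - (g x :: 'b::ab_group_add)"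
  by (simp add: fun_diff_def)

lemma scaleC_fun_apply [simp]: "(c *\<^sub>C u) k = c * (u k :: complex)"
  by (simp add: scaleC_fun_def scaleC_complex_def)

lemma weighted_l2_mem_iff_summable:
  "u \<in> hcarrier (weighted_l2 w) \<longleftrightarrow> (\<lambda>k. (w k * cmod (u k))\<^sup>2) summable_on UNIV"
  by (simp add: weighted_l2_def ell2_def norm_mult power_mult_distrib)

lemma weighted_l2_mem_iff:
  "u \<in> hcarrier (weighted_l2 w) \<longleftrightarrow> integrable (count_space UNIV) (\<lambda>k. (w k * cmod (u k))\<^sup>2)"
  by (simp only: weighted_l2_mem_iff_summable summable_on_real_iff_integrable)

lemma weighted_l2_inner_integrable:
  assumes "u \<in> hcarrier (weighted_l2 w)" "v \<in> hcarrier (weighted_l2 w)"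
  shows "integrable (count_space UNIV) (\<lambda>k. (complex_of_real (w k))\<^sup>2 * u k * cnj (v k))"
proof (rule Bochner_Integration.integrable_bound)
  show "integrable (count_space UNIV) (\<lambda>k. (w k * cmod (u k))\<^sup>2 + (w k * cmod (v k))\<^sup>2)"
    using assms by (simp add: weighted_l2_mem_iff)
  show "AE k in count_space UNIV. norm ((complex_of_real (w k))\<^sup>2 * u k * cnj (v k))
      \<le> norm ((w k * cmod (u k))\<^sup>2 + (w k * cmod (v k))\<^sup>2)"
  proof (rule AE_I2)
    fix k
    have "2 * (\<bar>w k\<bar> * cmod (u k)) * (\<bar>w k\<bar> * cmod (v k)) \<le> (w k * cmod (u k))\<^sup>2 + (w k * cmod (v k))\<^sup>2"
      using sum_squares_bound[of "\<bar>w k\<bar> * cmod (u k)" "\<bar>w k\<bar> * cmod (v k)"]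
      by (simp add: power_mult_distrib)
    moreover have "0 \<le> (\<bar>w k\<bar> * cmod (u k)) * (\<bar>w k\<bar> * cmod (v k))" by simp
    ultimately have "(\<bar>w k\<bar> * cmod (u k)) * (\<bar>w k\<bar> * cmod (v k)) \<le> (w k * cmod (u k))\<^sup>2 + (w k * cmod (v k))\<^sup>2"
      by linarith
    then show "norm ((complex_of_real (w k))\<^sup>2 * u k * cnj (v k))
        \<le> norm ((w k * cmod (u k))\<^sup>2 + (w k * cmod (v k))\<^sup>2)"
      by (simp add: norm_mult norm_power power2_eq_square mult_ac)
  qed
qed simp

lemma weighted_l2_inner:
  assumes "u \<in> hcarrier (weighted_l2 w)" "v \<in> hcarrier (weighted_l2 w)"
  shows "hinner (weighted_l2 w) u v
    = (\<integral>k. (complex_of_real (w k))\<^sup>2 * u k * cnj (v k) \<partial>count_space UNIV)"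
  using infsum_eq_integral[OF weighted_l2_inner_integrable[OF assms]] by (simp add: weighted_l2_def)

lemma weighted_l2_inner_self:
  assumes "u \<in> hcarrier (weighted_l2 w)"
  shows "hinner (weighted_l2 w) u u
    = complex_of_real (\<integral>k. (w k * cmod (u k))\<^sup>2 \<partial>count_space UNIV)"
proof -
  have "(complex_of_real (w k))\<^sup>2 * u k * cnj (u k) = complex_of_real ((w k * cmod (u k))\<^sup>2)" for k
    using complex_norm_square[of "u k"] by (simp add: power_mult_distrib mult.assoc)
  then show ?thesis
    using assms by (simp add: weighted_l2_inner del: of_real_power of_real_mult)
qed

lemma weighted_l2_hnorm_sq:
  assumes "u \<in> hcarrier (weighted_l2 w)"
  shows "(hnorm (weighted_l2 w) u)\<^sup>2 = (\<integral>k. (w k * cmod (u k))\<^sup>2 \<partial>count_space UNIV)"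
  using assms by (simp add: hnorm_def weighted_l2_inner_self)

lemma weighted_l2_hnorm_sq_infsum:
  assumes "u \<in> hcarrier (weighted_l2 w)"
  shows "(hnorm (weighted_l2 w) u)\<^sup>2 = (\<Sum>\<^sub>\<infinity>k. (w k * cmod (u k))\<^sup>2)"
  using assms infsetsum_infsum[of "\<lambda>k. (w k * cmod (u k))\<^sup>2" UNIV]
  by (simp add: weighted_l2_hnorm_sq weighted_l2_mem_iff infsetsum_def abs_summable_on_def)

lemma weighted_l2_sum_le:
  assumes "u \<in> hcarrier (weighted_l2 w)" "finite F"
  shows "(\<Sum>k\<in>F. (w k * cmod (u k))\<^sup>2) \<le> (hnorm (weighted_l2 w) u)\<^sup>2"
  using assms unfolding weighted_l2_hnorm_sq_infsum[OF assms(1)] weighted_l2_mem_iff_summable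
  by (intro finite_sum_le_infsum) auto

text \<open>
  Membership and a norm bound follow from a bound on the finite partial sums. Most estimates below go
  through this lemma.
\<close>

lemma weighted_l2_memI:
  assumes "\<And>F. finite F \<Longrightarrow> (\<Sum>k\<in>F. (w k * cmod (u k))\<^sup>2) \<le> B"
  shows "u \<in> hcarrier (weighted_l2 w)" and "(hnorm (weighted_l2 w) u)\<^sup>2 \<le> B"
proof -
  show mem: "u \<in> hcarrier (weighted_l2 w)"
    unfolding weighted_l2_mem_iff_summable
    by (rule nonneg_bdd_above_summable_on) (use assms in \<open>auto intro!: bdd_aboveI\<close>)
  show "(hnorm (weighted_l2 w) u)\<^sup>2 \<le> B"
    using mem assms unfolding weighted_l2_hnorm_sq_infsum[OF mem]
    by (intro infsum_le_finite_sums) (auto simp: weighted_l2_mem_iff_summable)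
qed

definition delta :: "'i \<Rightarrow> 'i \<Rightarrow> complex"
  where "delta k = (\<lambda>j. if j = k then 1 else 0)"

lemma finite_support_mem:
  assumes "finite {k. u k \<noteq> 0}"
  shows "u \<in> hcarrier (weighted_l2 w)"
proof (rule weighted_l2_memI(1))
  fix F :: "'a set" assume "finite F"
  have "(\<Sum>k\<in>F. (w k * cmod (u k))\<^sup>2) = (\<Sum>k\<in>F \<inter> {k. u k \<noteq> 0}. (w k * cmod (u k))\<^sup>2)"
    using \<open>finite F\<close> by (intro sum.mono_neutral_right) auto
  also have "\<dots> \<le> (\<Sum>k\<in>{k. u k \<noteq> 0}. (w k * cmod (u k))\<^sup>2)"
    using assms by (intro sum_mono2) auto
  finally show "(\<Sum>k\<in>F. (w k * cmod (u k))\<^sup>2) \<le> (\<Sum>k\<in>{k. u k \<noteq> 0}. (w k * cmod (u k))\<^sup>2)" .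
qed

lemma delta_mem [simp]: "delta k \<in> hcarrier (weighted_l2 w)"
  by (rule finite_support_mem) (simp add: delta_def)

lemma weighted_l2_inner_delta:
  "hinner (weighted_l2 w) u (delta k) = (complex_of_real (w k))\<^sup>2 * u k"
proof -
  have "(\<Sum>\<^sub>\<infinity>j. (complex_of_real (w j))\<^sup>2 * u j * cnj (delta k j))
      = (\<Sum>\<^sub>\<infinity>j\<in>{k}. (complex_of_real (w j))\<^sup>2 * u j * cnj (delta k j))"
    by (rule infsum_cong_neutral) (auto simp: delta_def)
  then show ?thesis by (simp add: weighted_l2_def delta_def)
qed

lemma weighted_l2_inner_delta_left:
  "hinner (weighted_l2 w) (delta k) v = (complex_of_real (w k))\<^sup>2 * cnj (v k)"
proof -
  have "(\<Sum>\<^sub>\<infinity>j. (complex_of_real (w j))\<^sup>2 * delta k j * cnj (v j))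
      = (\<Sum>\<^sub>\<infinity>j\<in>{k}. (complex_of_real (w j))\<^sup>2 * delta k j * cnj (v j))"
    by (rule infsum_cong_neutral) (auto simp: delta_def)
  then show ?thesis by (simp add: weighted_l2_def delta_def)
qed

locale positive_weight =
  fixes w :: "'i::countable \<Rightarrow> real"
  assumes w_pos: "0 < w k"
begin

abbreviation "L \<equiv> weighted_l2 w"

lemma dominated:
  assumes "u \<in> hcarrier L" "\<And>k. cmod (v k) \<le> cmod (u k)"
  shows "v \<in> hcarrier L" and "(hnorm L v)\<^sup>2 \<le> (hnorm L u)\<^sup>2"
proof -
  have "(\<Sum>k\<in>F. (w k * cmod (v k))\<^sup>2) \<le> (hnorm L u)\<^sup>2" if "finite F" for F
  proof -
    have "(\<Sum>k\<in>F. (w k * cmod (v k))\<^sup>2) \<le> (\<Sum>k\<in>F. (w k * cmod (u k))\<^sup>2)"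
      using assms w_pos by (intro sum_mono power_mono mult_left_mono) (auto simp: less_imp_le)
    also have "\<dots> \<le> (hnorm L u)\<^sup>2" by (rule weighted_l2_sum_le[OF assms(1) that])
    finally show ?thesis .
  qed
  from weighted_l2_memI[OF this]
  show "v \<in> hcarrier L" and "(hnorm L v)\<^sup>2 \<le> (hnorm L u)\<^sup>2" by blast+
qed

lemma subspace: "complex_vector.subspace (hcarrier L)"
proof (rule complex_vector.subspaceI)
  show "0 \<in> hcarrier L" by (rule finite_support_mem) simp
next
  fix u v assume u: "u \<in> hcarrier L" and v: "v \<in> hcarrier L"
  show "u + v \<in> hcarrier L"
    unfolding weighted_l2_mem_iff
  proof (rule Bochner_Integration.integrable_bound)
    show "integrable (count_space UNIV) (\<lambda>k. 2 * (w k * cmod (u k))\<^sup>2 + 2 * (w k * cmod (v k))\<^sup>2)"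
      using u v by (simp add: weighted_l2_mem_iff)
    show "AE k in count_space UNIV. norm ((w k * cmod ((u + v) k))\<^sup>2)
        \<le> norm (2 * (w k * cmod (u k))\<^sup>2 + 2 * (w k * cmod (v k))\<^sup>2)"
    proof (rule AE_I2)
      fix k
      have "(w k * cmod (u k + v k))\<^sup>2 \<le> (w k * cmod (u k) + w k * cmod (v k))\<^sup>2"
        using w_pos[of k] norm_triangle_ineq[of "u k" "v k"]
        by (intro power_mono) (auto simp flip: distrib_left simp: mult_left_mono)
      also have "\<dots> \<le> 2 * (w k * cmod (u k))\<^sup>2 + 2 * (w k * cmod (v k))\<^sup>2"
        using sum_squares_bound[of "w k * cmod (u k)" "w k * cmod (v k)"] by (simp add: power2_sum)
      finally show "norm ((w k * cmod ((u + v) k))\<^sup>2)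
        \<le> norm (2 * (w k * cmod (u k))\<^sup>2 + 2 * (w k * cmod (v k))\<^sup>2)" by simp
    qed
  qed simp
next
  fix c u assume "u \<in> hcarrier L"
  then show "c *\<^sub>C u \<in> hcarrier L"
    by (simp add: weighted_l2_mem_iff norm_mult power_mult_distrib mult.left_commute[of _ "(cmod c)\<^sup>2"])
qed

sublocale pre_hilbert L
proof
  show "complex_vector.subspace (hcarrier L)" by (rule subspace)
next
  fix v assume v: "v \<in> hcarrier L"
  show "linear_on (hcarrier L) (\<lambda>u. hinner L u v)"
    unfolding linear_on_def
  proof (intro conjI ballI allI)
    fix u u' assume u: "u \<in> hcarrier L" "u' \<in> hcarrier L"
    then have "u + u' \<in> hcarrier L" using subspace by (simp add: complex_vector.subspace_add)
    then show "hinner L (u + u') v = hinner L u v + hinner L u' v"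
      using u v weighted_l2_inner_integrable[of _ w v]
      by (simp add: weighted_l2_inner algebra_simps flip: Bochner_Integration.integral_add)
  next
    fix c u assume u: "u \<in> hcarrier L"
    then have "c *\<^sub>C u \<in> hcarrier L" using subspace by (simp add: complex_vector.subspace_scale)
    then show "hinner L (c *\<^sub>C u) v = c *\<^sub>C hinner L u v"
      using u v
      by (simp add: weighted_l2_inner scaleC_complex_def mult.assoc mult.left_commute[of _ c])
  qed
next
  fix u v assume uv: "u \<in> hcarrier L" "v \<in> hcarrier L"
  have "cnj (hinner L v u) = (\<Sum>\<^sub>\<infinity>k. cnj ((complex_of_real (w k))\<^sup>2 * v k * cnj (u k)))"
    by (simp add: weighted_l2_def flip: infsum_cnj)
  also have "\<dots> = hinner L u v" by (simp add: weighted_l2_def mult_ac)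
  finally show "hinner L u v = cnj (hinner L v u)" by simp
next
  fix u assume u: "u \<in> hcarrier L" and "u \<noteq> 0"
  then obtain k where k: "u k \<noteq> 0" by (auto simp: fun_eq_iff)
  have "0 < (\<Sum>k\<in>{k}. (w k * cmod (u k))\<^sup>2)" using k w_pos[of k] by simp
  also have "\<dots> \<le> (hnorm L u)\<^sup>2" using u by (intro weighted_l2_sum_le) auto
  also have "\<dots> = Re (hinner L u u)" using u by (simp add: weighted_l2_hnorm_sq weighted_l2_inner_self)
  finally show "0 < Re (hinner L u u)" .
qed

lemma hnorm_dominated:
  assumes "u \<in> hcarrier L" "\<And>k. cmod (v k) \<le> cmod (u k)"
  shows "hnorm L v \<le> hnorm L u"
  by (rule power2_le_imp_le[OF dominated(2)[OF assms]]) (use assms(1) in \<open>simp add: hnorm_nonneg\<close>)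

lemma coordinate_le:
  assumes "u \<in> hcarrier L"
  shows "w k * cmod (u k) \<le> hnorm L u"
  by (rule power2_le_imp_le) (use weighted_l2_sum_le[OF assms, of "{k}"] hnorm_nonneg[OF assms] in simp_all)

text \<open>
  Together with the finite part, on which everything is explicit, this replaces limits over the index set
  in the proofs of density, separability and countable additivity.
\<close>

lemma small_tail:
  assumes u: "u \<in> hcarrier L" and e: "0 < e"
  obtains F where "finite F" "hnorm L (\<lambda>k. if k \<in> F then 0 else u k) < e"
proof -
  let ?f = "\<lambda>k. (w k * cmod (u k))\<^sup>2"
  have "(?f has_sum (hnorm L u)\<^sup>2) UNIV"
    using u by (simp add: weighted_l2_hnorm_sq_infsum weighted_l2_mem_iff_summable)
  then have "\<forall>\<^sub>F F in finite_subsets_at_top UNIV. (hnorm L u)\<^sup>2 - (e/2)\<^sup>2 < sum ?f F"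
    unfolding has_sum_def using e by (intro order_tendstoD(1)) auto
  then obtain F where F: "finite F" "(hnorm L u)\<^sup>2 - (e/2)\<^sup>2 < sum ?f F"
    by (auto simp: eventually_finite_subsets_at_top)
  let ?v = "\<lambda>k. if k \<in> F then 0 else u k"
  have "(\<Sum>k\<in>G. (w k * cmod (?v k))\<^sup>2) \<le> (e/2)\<^sup>2" if G: "finite G" for G
  proof -
    have "(\<Sum>k\<in>G. (w k * cmod (?v k))\<^sup>2) = (\<Sum>k\<in>G - F. ?f k)"
      using G by (intro sum.mono_neutral_cong_right) auto
    moreover have "(\<Sum>k\<in>G - F. ?f k) + sum ?f F = sum ?f (G \<union> F)"
      using G F(1) by (subst sum.union_disjoint[symmetric]) (auto intro: sum.cong)
    moreover have "sum ?f (G \<union> F) \<le> (hnorm L u)\<^sup>2"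
      using u G F(1) by (intro weighted_l2_sum_le) auto
    ultimately show ?thesis using F(2) by linarith
  qed
  from weighted_l2_memI[OF this]
  have "?v \<in> hcarrier L" "(hnorm L ?v)\<^sup>2 \<le> (e/2)\<^sup>2" by blast+
  then have "hnorm L ?v \<le> e/2" using e power2_le_imp_le[of "hnorm L ?v" "e/2"] by simp
  then have "hnorm L ?v < e" using e by linarith
  then show ?thesis using F(1) that by blast
qed

text \<open>
  The pointwise limit of a Cauchy sequence is its limit in norm: on each finite set of indices the
  Cauchy estimate passes to the limit, and the bound is uniform in the finite set.
\<close>

lemma complete: "mcomplete"
  unfolding mcomplete_def
proof (intro allI impI)
  fix x assume x: "MCauchy x"
  have mem: "x n \<in> hcarrier L" for n using x by (auto simp: MCauchy_def)
  have cauchy: "\<exists>N. \<forall>n\<ge>N. \<forall>m\<ge>N. hnorm L (x n - x m) < e" if "0 < e" for e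
    using x that mem by (fastforce simp: MCauchy_def hdist_eq)
  have "Cauchy (\<lambda>n. x n k)" for k
  proof (rule CauchyI)
    fix e :: real assume "0 < e"
    then have "0 < w k * e" using w_pos[of k] by simp
    then obtain N where N: "\<And>n m. N \<le> n \<Longrightarrow> N \<le> m \<Longrightarrow> hnorm L (x n - x m) < w k * e"
      using cauchy by blast
    have "norm (x n k - x m k) < e" if "N \<le> n" "N \<le> m" for n m
    proof -
      have "w k * cmod ((x n - x m) k) < w k * e"
        using coordinate_le[of "x n - x m" k] N[OF that] mem by force
      then show ?thesis using w_pos[of k] by simp
    qed
    then show "\<exists>N. \<forall>n\<ge>N. \<forall>m\<ge>N. norm (x n k - x m k) < e" by blast
  qed
  then have "\<forall>k. \<exists>l. (\<lambda>n. x n k) \<longlonglongrightarrow> l"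
    by (simp add: Cauchy_convergent_iff convergent_def)
  then obtain l where l: "\<And>k. (\<lambda>n. x n k) \<longlonglongrightarrow> l k" by metis
  have close: "\<exists>N. \<forall>n\<ge>N. x n - l \<in> hcarrier L \<and> hnorm L (x n - l) \<le> e" if e: "0 < e" for e
  proof -
    obtain N where N: "\<And>n m. N \<le> n \<Longrightarrow> N \<le> m \<Longrightarrow> hnorm L (x n - x m) < e"
      using cauchy[OF e] by blast
    have "x n - l \<in> hcarrier L \<and> hnorm L (x n - l) \<le> e" if n: "N \<le> n" for n
    proof -
      have "(\<Sum>k\<in>F. (w k * cmod ((x n - l) k))\<^sup>2) \<le> e\<^sup>2" if F: "finite F" for F
      proof (rule tendsto_upperbound)
        show "(\<lambda>m. \<Sum>k\<in>F. (w k * cmod ((x n - x m) k))\<^sup>2) \<longlonglongrightarrow> (\<Sum>k\<in>F. (w k * cmod ((x n - l) k))\<^sup>2)"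
          using l by (auto intro!: tendsto_intros)
        have "(\<Sum>k\<in>F. (w k * cmod ((x n - x m) k))\<^sup>2) \<le> e\<^sup>2" if m: "N \<le> m" for m
        proof -
          have d: "x n - x m \<in> hcarrier L" using mem by simp
          have "(\<Sum>k\<in>F. (w k * cmod ((x n - x m) k))\<^sup>2) \<le> (hnorm L (x n - x m))\<^sup>2"
            by (rule weighted_l2_sum_le[OF d F])
          also have "\<dots> \<le> e\<^sup>2"
            using N[OF n m] hnorm_nonneg[OF d] by (intro power_mono) auto
          finally show ?thesis .
        qed
        then show "\<forall>\<^sub>F m in sequentially. (\<Sum>k\<in>F. (w k * cmod ((x n - x m) k))\<^sup>2) \<le> e\<^sup>2"
          unfolding eventually_sequentially by blast
      qed simp
      note bound = weighted_l2_memI[where u = "x n - l" and w = w and B = "e\<^sup>2", OF this]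
      then show ?thesis using e power2_le_imp_le[OF bound(2)] by (auto simp only: less_imp_le)
    qed
    then show ?thesis by blast
  qed
  obtain N where "x N - l \<in> hcarrier L" using close[of 1] by auto
  from diff_mem[OF mem[of N] this] have lH: "l \<in> hcarrier L" by simp
  have "(\<lambda>n. hnorm L (x n - l)) \<longlonglongrightarrow> 0"
  proof (rule LIMSEQ_I)
    fix e :: real assume "0 < e"
    then obtain N where "\<And>n. N \<le> n \<Longrightarrow> hnorm L (x n - l) \<le> e / 2" using close[of "e/2"] by auto
    then have "norm (hnorm L (x n - l) - 0) < e" if "N \<le> n" for n
      using hnorm_nonneg[of "x n - l"] mem lH that \<open>0 < e\<close> by fastforce
    then show "\<exists>N. \<forall>n\<ge>N. norm (hnorm L (x n - l) - 0) < e" by blast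
  qed
  then show "\<exists>l. limitin mtopology x l sequentially"
    using mem lH limitin_iff by blast
qed

lemma hilbert_space_weighted_l2: "hilbert_space L"
  using complete pre_hilbert_axioms by (simp add: hilbert_space_iff)

lemma finite_support_dense:
  "mtopology closure_of {u. finite {k. u k \<noteq> 0}} = hcarrier L"
proof (subst dense_iff)
  show "{u. finite {k. u k \<noteq> 0}} \<subseteq> hcarrier L" using finite_support_mem by auto
  show "\<forall>u\<in>hcarrier L. \<forall>r>0. \<exists>v\<in>{u. finite {k. u k \<noteq> 0}}. hnorm L (u - v) < r"
  proof (intro ballI allI impI)
    fix u r assume "u \<in> hcarrier L" "0 < (r::real)"
    then obtain F where F: "finite F" "hnorm L (\<lambda>k. if k \<in> F then 0 else u k) < r"
      using small_tail by metis
    let ?v = "\<lambda>k. if k \<in> F then u k else 0"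
    have "{k. ?v k \<noteq> 0} \<subseteq> F" by auto
    then have "finite {k. ?v k \<noteq> 0}" using F(1) by (rule finite_subset)
    moreover have "u - ?v = (\<lambda>k. if k \<in> F then 0 else u k)" by (auto simp: fun_eq_iff)
    ultimately show "\<exists>v\<in>{u. finite {k. u k \<noteq> 0}}. hnorm L (u - v) < r"
      using F(2) by (intro bexI[of _ ?v]) (simp_all only: mem_Collect_eq)
  qed
qed

text \<open>The finitely supported functions with values in \<open>\<rat> + \<i>\<rat>\<close> form a countable dense set.\<close>

lemma separable: "separable_space mtopology"
proof -
  define h :: "rat \<times> rat \<Rightarrow> complex" where "h = (\<lambda>(p, q). Complex (of_rat p) (of_rat q))"
  define g :: "('i \<times> rat \<times> rat) list \<Rightarrow> 'i \<Rightarrow> complex"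
    where "g xs k = (case map_of xs k of None \<Rightarrow> 0 | Some p \<Rightarrow> h p)" for xs k
  have supp: "finite {k. g xs k \<noteq> 0}" for xs
    by (rule finite_subset[of _ "dom (map_of xs)"])
      (auto simp: g_def finite_dom_map_of split: option.splits)
  have g_mem: "g xs \<in> hcarrier L" for xs by (rule finite_support_mem[OF supp])
  have rat_dense: "\<exists>p. cmod (z - h p) < e" if e: "0 < e" for z e
  proof -
    obtain p where p: "Re z - e/2 < of_rat p" "of_rat p < Re z + e/2"
      using of_rat_dense[of "Re z - e/2" "Re z + e/2"] e by auto
    obtain q where q: "Im z - e/2 < of_rat q" "of_rat q < Im z + e/2"
      using of_rat_dense[of "Im z - e/2" "Im z + e/2"] e by auto
    have "cmod (z - h (p, q)) \<le> \<bar>Re (z - h (p, q))\<bar> + \<bar>Im (z - h (p, q))\<bar>" by (rule cmod_le)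
    also have "\<dots> < e" using p q by (simp add: h_def abs_if field_simps)
    finally show ?thesis by blast
  qed
  have "mtopology closure_of range g = hcarrier L"
  proof (subst dense_iff)
    show "range g \<subseteq> hcarrier L" using g_mem by auto
    show "\<forall>u\<in>hcarrier L. \<forall>r>0. \<exists>v\<in>range g. hnorm L (u - v) < r"
    proof (intro ballI allI impI)
      fix u r assume u: "u \<in> hcarrier L" and r: "0 < (r::real)"
      then obtain F where F: "finite F" "hnorm L (\<lambda>k. if k \<in> F then 0 else u k) < r/2"
        using small_tail[of u "r/2"] by auto
      \<comment> \<open>Accuracy e in the coordinates of F gives squared norm at most (s - 1) * e * e, hence at most
        (r / 3) * (r / 3); the summand 1 makes s positive when F is empty.\<close>
      define s where "s = (\<Sum>k\<in>F. (w k)\<^sup>2) + 1"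
      have s: "1 \<le> s" by (simp add: s_def sum_nonneg)
      define e where "e = r / (3 * s)"
      have e: "0 < e" using r s by (simp add: e_def)
      have "\<forall>k. \<exists>p. cmod (u k - h p) < e" using rat_dense[OF e] by blast
      from choice[OF this] obtain c where c: "\<And>k. cmod (u k - h (c k)) < e" by blast
      obtain ks where ks: "set ks = F" using F(1) finite_list by blast
      define v where "v = g (map (\<lambda>k. (k, c k)) ks)"
      have v: "v k = (if k \<in> F then h (c k) else 0)" for k
        by (simp add: v_def g_def map_of_map_restrict ks restrict_map_def)
      define a where "a = (\<lambda>k. if k \<in> F then u k - h (c k) else 0)"
      have "(\<Sum>k\<in>G. (w k * cmod (a k))\<^sup>2) \<le> (r/3)\<^sup>2" if G: "finite G" for G
      proof -
        have "(\<Sum>k\<in>G. (w k * cmod (a k))\<^sup>2) = (\<Sum>k\<in>G \<inter> F. (w k * cmod (a k))\<^sup>2)"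
          using G by (intro sum.mono_neutral_right) (auto simp: a_def)
        also have "\<dots> \<le> (\<Sum>k\<in>F. (w k * cmod (a k))\<^sup>2)"
          using F(1) by (intro sum_mono2) auto
        also have "\<dots> \<le> (\<Sum>k\<in>F. (w k)\<^sup>2 * e\<^sup>2)"
          unfolding power_mult_distrib using less_imp_le[OF c]
          by (intro sum_mono mult_left_mono power_mono) (auto simp: a_def)
        also have "\<dots> = (s - 1) * e\<^sup>2" by (simp add: s_def sum_distrib_right)
        also have "\<dots> \<le> (s * s) * e\<^sup>2"
        proof (rule mult_right_mono)
          have "1 * s \<le> s * s" using s by (intro mult_right_mono) auto
          then show "s - 1 \<le> s * s" by linarith
        qed simp
        also have "\<dots> = (r/3)\<^sup>2" using s by (simp add: e_def power2_eq_square)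
        finally show ?thesis .
      qed
      from weighted_l2_memI[OF this]
      have a: "a \<in> hcarrier L" "hnorm L a \<le> r/3"
        using r power2_le_imp_le[of "hnorm L a" "r/3"] by simp_all
      have t: "(\<lambda>k. if k \<in> F then 0 else u k) \<in> hcarrier L"
        by (rule dominated(1)[OF u]) auto
      have "u - v = a + (\<lambda>k. if k \<in> F then 0 else u k)" by (auto simp: fun_eq_iff v a_def)
      then have "hnorm L (u - v) \<le> hnorm L a + hnorm L (\<lambda>k. if k \<in> F then 0 else u k)"
        using hnorm_triangle[OF a(1) t] by simp
      then have "hnorm L (u - v) < r" using a(2) F(2) r by linarith
      then show "\<exists>v\<in>range g. hnorm L (u - v) < r" by (auto simp: v_def)
    qed
  qed
  then show ?thesis
    using g_mem unfolding separable_space_def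
    by (intro exI[of _ "range g"]) auto
qed

lemma separable_hilbert_space_weighted_l2: "separable_hilbert_space L"
  using hilbert_space_weighted_l2 separable by (simp add: separable_hilbert_space_def)

end

section \<open>Pairs of weighted spaces and their interpolation spaces\<close>

definition multiplication :: "('i \<Rightarrow> real) \<Rightarrow> ('i \<Rightarrow> complex) \<Rightarrow> 'i \<Rightarrow> complex"
  where "multiplication g u = (\<lambda>k. complex_of_real (g k) * u k)"

lemma multiplication_mem_iff:
  "multiplication g u \<in> hcarrier (weighted_l2 w) \<longleftrightarrow> u \<in> hcarrier (weighted_l2 (\<lambda>k. w k * g k))"
  by (simp add: multiplication_def weighted_l2_def mult.assoc)

lemma inner_multiplication:
  "hinner (weighted_l2 w) (multiplication g u) (multiplication g v)
    = hinner (weighted_l2 (\<lambda>k. w k * g k)) u v"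
  by (simp add: multiplication_def weighted_l2_def power2_eq_square mult_ac)

lemma hnorm_multiplication:
  "hnorm (weighted_l2 w) (multiplication g u) = hnorm (weighted_l2 (\<lambda>k. w k * g k)) u"
  by (simp add: hnorm_def inner_multiplication)

lemma linear_multiplication: "linear_on D (multiplication g)"
  by (simp add: linear_on_def multiplication_def fun_eq_iff distrib_left)

text \<open>
  The constant is kept in the norm bound because it yields the continuity of the embeddings and the
  boundedness of permutations of coordinates.
\<close>

lemma weighted_l2_mono:
  assumes w: "\<And>k. \<bar>w k\<bar> \<le> C * \<bar>w' k\<bar>" and C: "0 \<le> C" and u: "u \<in> hcarrier (weighted_l2 w')"
  shows "u \<in> hcarrier (weighted_l2 w)" and "hnorm (weighted_l2 w) u \<le> C * hnorm (weighted_l2 w') u"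
proof -
  have "(\<Sum>k\<in>F. (w k * cmod (u k))\<^sup>2) \<le> (C * hnorm (weighted_l2 w') u)\<^sup>2" if F: "finite F" for F
  proof -
    have "(w k * cmod (u k))\<^sup>2 \<le> C\<^sup>2 * (w' k * cmod (u k))\<^sup>2" for k
    proof -
      have "(\<bar>w k\<bar> * cmod (u k))\<^sup>2 \<le> (C * \<bar>w' k\<bar> * cmod (u k))\<^sup>2"
        using w[of k] by (intro power_mono mult_right_mono) auto
      then show ?thesis by (simp add: power_mult_distrib)
    qed
    then have "(\<Sum>k\<in>F. (w k * cmod (u k))\<^sup>2) \<le> (\<Sum>k\<in>F. C\<^sup>2 * (w' k * cmod (u k))\<^sup>2)"
      by (rule sum_mono)
    also have "\<dots> \<le> C\<^sup>2 * (hnorm (weighted_l2 w') u)\<^sup>2"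
      using weighted_l2_sum_le[OF u F] by (simp add: sum_distrib_left[symmetric] mult_left_mono)
    finally show ?thesis by (simp add: power_mult_distrib)
  qed
  note bound = weighted_l2_memI[OF this]
  show "u \<in> hcarrier (weighted_l2 w)" by (rule bound)
  have "0 \<le> hnorm (weighted_l2 w') u" using u by (simp add: hnorm_def weighted_l2_inner_self)
  then show "hnorm (weighted_l2 w) u \<le> C * hnorm (weighted_l2 w') u"
    using C by (intro power2_le_imp_le[OF bound(2)] mult_nonneg_nonneg)
qed

locale weight_pair =
  fixes w0 w1 :: "'i::countable \<Rightarrow> real" and r :: real
  assumes w0_pos: "0 < w0 k" and r_pos: "0 < r" and ratio: "r * w0 k \<le> w1 k"
begin

lemma w1_pos: "0 < w1 k"
  using mult_pos_pos[OF r_pos w0_pos[of k]] ratio[of k] by linarith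

sublocale L0: positive_weight w0 by unfold_locales (rule w0_pos)
sublocale L1: positive_weight w1 by unfold_locales (rule w1_pos)

abbreviation "H0 \<equiv> weighted_l2 w0"
abbreviation "H1 \<equiv> weighted_l2 w1"

definition m :: "'i \<Rightarrow> real" where "m k = w1 k / w0 k"

lemma m_ge: "r \<le> m k"
  using ratio[of k] w0_pos[of k] by (simp add: m_def field_simps)

lemma m_pos: "0 < m k"
  using m_ge[of k] r_pos by linarith

lemma w0_m: "w0 k * m k = w1 k"
  using w0_pos[of k] by (simp add: m_def)

lemma embedding:
  assumes "u \<in> hcarrier H1"
  shows "u \<in> hcarrier H0" and "hnorm H0 u \<le> 1 / r * hnorm H1 u"
proof -
  have le: "\<bar>w0 k\<bar> \<le> 1 / r * \<bar>w1 k\<bar>" for k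
    using ratio[of k] r_pos w0_pos[of k] w1_pos[of k] by (simp add: field_simps)
  show "u \<in> hcarrier H0" "hnorm H0 u \<le> 1 / r * hnorm H1 u"
    using weighted_l2_mono[OF le _ assms] r_pos by simp_all
qed

lemma H1_dense: "L0.mtopology closure_of (hcarrier H1) = hcarrier H0"
proof (rule L0.dense_superset[OF L0.finite_support_dense])
  show "{u. finite {k. u k \<noteq> 0}} \<subseteq> hcarrier H1" using finite_support_mem by auto
  show "hcarrier H1 \<subseteq> hcarrier H0" using embedding by auto
qed

lemma admissible: "admissible_pair H0 H1"
  unfolding admissible_pair_def
proof (intro conjI)
  show "separable_hilbert_space H0" by (rule L0.separable_hilbert_space_weighted_l2)
  show "separable_hilbert_space H1" by (rule L1.separable_hilbert_space_weighted_l2)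
  show "hcarrier H1 \<subseteq> hcarrier H0" using embedding by auto
  show "L0.mtopology closure_of hcarrier H1 = hcarrier H0" by (rule H1_dense)
  show "continuous_map L1.mtopology L0.mtopology (\<lambda>u. u)"
    unfolding L1.metric_continuous_map[OF L0.Metric_space_axioms]
  proof (intro conjI ballI allI impI)
    show "(\<lambda>u. u) ` hcarrier H1 \<subseteq> hcarrier H0" using embedding by auto
    fix a e assume a: "a \<in> hcarrier H1" and e: "0 < (e::real)"
    have "hdist H0 a x < e" if x: "x \<in> hcarrier H1 \<and> hdist H1 a x < r * e" for x
    proof -
      have d: "a - x \<in> hcarrier H1" using a x by simp
      have "hnorm H0 (a - x) \<le> 1 / r * hnorm H1 (a - x)" by (rule embedding(2)[OF d])
      also have "\<dots> < e" using x a r_pos L1.hdist_eq[of a x] by (simp add: field_simps)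
      finally show ?thesis using a x embedding(1) by (simp add: L0.hdist_eq)
    qed
    then show "\<exists>\<delta>>0. \<forall>x. x \<in> hcarrier H1 \<and> hdist H1 a x < \<delta> \<longrightarrow> hdist H0 a x < e"
      using e r_pos by (intro exI[of _ "r * e"]) auto
  qed
qed

subsection \<open>The generating operator\<close>

definition J :: "('i \<Rightarrow> complex) \<Rightarrow> 'i \<Rightarrow> complex"
  where "J = (\<lambda>u\<in>hcarrier H1. multiplication m u)"

lemma multiplication_m_mem: "multiplication m u \<in> hcarrier H0 \<longleftrightarrow> u \<in> hcarrier H1"
  by (simp add: multiplication_mem_iff w0_m)

lemma J_delta: "J (delta k) = complex_of_real (m k) *\<^sub>C delta k"
proof -
  have "multiplication m (delta k) = complex_of_real (m k) *\<^sub>C delta k"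
    by (auto simp: multiplication_def delta_def fun_eq_iff)
  then show ?thesis by (simp add: J_def)
qed

lemma J_positive_selfadjoint: "positive_selfadjoint H0 (hcarrier H1) J"
  unfolding positive_selfadjoint_def
proof (intro conjI ballI impI)
  show "J \<in> hcarrier H1 \<rightarrow>\<^sub>E hcarrier H0"
    by (auto simp: J_def multiplication_m_mem)
  show "hcarrier H1 \<subseteq> hcarrier H0" using embedding by auto
  show "complex_vector.subspace (hcarrier H1)" by (rule L1.subspace)
  show "L0.mtopology closure_of hcarrier H1 = hcarrier H0" by (rule H1_dense)
  show "linear_on (hcarrier H1) J"
    using linear_multiplication[of "hcarrier H1" m] by (simp add: linear_on_def J_def)
next
  fix v w assume v: "v \<in> hcarrier H0" and w: "w \<in> hcarrier H0"
  show "(v \<in> hcarrier H1 \<and> J v = w) \<longleftrightarrow> (\<forall>u\<in>hcarrier H1. hinner H0 (J u) v = hinner H0 u w)"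
  proof
    assume "v \<in> hcarrier H1 \<and> J v = w"
    then have "w = multiplication m v" by (auto simp: J_def)
    then show "\<forall>u\<in>hcarrier H1. hinner H0 (J u) v = hinner H0 u w"
      by (simp add: J_def weighted_l2_def multiplication_def mult_ac)
  next
    assume "\<forall>u\<in>hcarrier H1. hinner H0 (J u) v = hinner H0 u w"
    then have adj: "hinner H0 (J (delta k)) v = hinner H0 (delta k) w" for k by simp
    then have eig: "complex_of_real (m k) * hinner H0 (delta k) v = hinner H0 (delta k) w" for k
      using L0.inner_scale_left[of "delta k" v "complex_of_real (m k)"] adj[of k] v
      by (simp add: J_delta)
    have "complex_of_real (m k) * cnj (v k) = cnj (w k)" for k
      using eig[of k] w0_pos[of k] by (simp add: weighted_l2_inner_delta_left)
    then have "w k = complex_of_real (m k) * v k" for k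
      by (metis complex_cnj_cnj complex_cnj_complex_of_real complex_cnj_mult)
    then have "w = multiplication m v" by (simp add: multiplication_def fun_eq_iff)
    then show "v \<in> hcarrier H1 \<and> J v = w"
      using w by (simp add: J_def multiplication_m_mem)
  qed
next
  fix u assume u: "u \<in> hcarrier H1" "u \<noteq> 0"
  \<comment> \<open>\<open>(J u, u)\<close> is the squared norm of \<open>u\<close> for the weight \<open>w0 * sqrt m\<close>, which is at most a multiple of \<open>w1\<close>.\<close>
  let ?s = "\<lambda>k. sqrt (m k)"
  interpret P: positive_weight "\<lambda>k. w0 k * ?s k"
    by unfold_locales (simp add: w0_pos m_pos)
  have le: "\<bar>w0 k * ?s k\<bar> \<le> (1 / sqrt r) * \<bar>w1 k\<bar>" for k
  proof -
    have "sqrt r * ?s k \<le> ?s k * ?s k"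
      using m_ge[of k] m_pos[of k] by (intro mult_right_mono) auto
    then have "?s k \<le> m k / sqrt r" using r_pos m_pos[of k] by (simp add: field_simps)
    then have "w0 k * ?s k \<le> w0 k * (m k / sqrt r)"
      using w0_pos[of k] by (intro mult_left_mono) auto
    also have "\<dots> = 1 / sqrt r * w1 k" by (simp flip: w0_m)
    finally show ?thesis using w0_pos[of k] m_pos[of k] w1_pos[of k] by (simp add: abs_mult)
  qed
  have "u \<in> hcarrier P.L" by (rule weighted_l2_mono(1)[OF le _ u(1)]) (use r_pos in simp)
  then have "0 < Re (hinner P.L u u)" using u(2) by (rule P.inner_pos)
  moreover have "hinner P.L u u = hinner H0 (J u) u"
  proof -
    have "(complex_of_real (?s k))\<^sup>2 = complex_of_real (m k)" for k
      using m_pos[of k] by (simp flip: of_real_power)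
    then show ?thesis
      using u by (simp add: J_def weighted_l2_def multiplication_def power_mult_distrib mult.assoc)
  qed
  ultimately show "0 < Re (hinner H0 (J u) u)" by simp
qed

lemma J_isometric: "u \<in> hcarrier H1 \<Longrightarrow> hnorm H0 (J u) = hnorm H1 u"
  by (simp add: J_def hnorm_multiplication w0_m)

text \<open>
  For a competitor \<open>K\<close> polarization gives \<open>(Ku, Ke) = (u, m\<^sup>2 e)\<close> for each unit vector \<open>e\<close>, so that
  \<open>K\<^sup>2 e = m\<^sup>2 e\<close> by self-adjointness. Then \<open>f = Ke - m e\<close> satisfies \<open>Kf = -m f\<close>, which positivity
  forbids unless \<open>f = 0\<close>. Symmetry extends \<open>K = J\<close> from the unit vectors to all vectors.
\<close>

lemma generating_operator_eq: "generating_operator H0 H1 = J"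
  unfolding generating_operator_def
proof (rule the_equality)
  show "positive_selfadjoint H0 (hcarrier H1) J \<and> (\<forall>u\<in>hcarrier H1. hnorm H0 (J u) = hnorm H1 u)"
    using J_positive_selfadjoint J_isometric by blast
next
  fix K
  assume K: "positive_selfadjoint H0 (hcarrier H1) K \<and> (\<forall>u\<in>hcarrier H1. hnorm H0 (K u) = hnorm H1 u)"
  note K_props = K[unfolded positive_selfadjoint_def]
  have K_ext: "K \<in> hcarrier H1 \<rightarrow>\<^sub>E hcarrier H0" using K_props by (elim conjE)
  have K_lin: "linear_on (hcarrier H1) K" using K_props by (elim conjE)
  have K_iso: "\<forall>u\<in>hcarrier H1. hnorm H0 (K u) = hnorm H1 u" using K_props by (elim conjE)
  have "\<forall>v\<in>hcarrier H0. \<forall>w\<in>hcarrier H0.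
      v \<in> hcarrier H1 \<and> K v = w \<longleftrightarrow> (\<forall>u\<in>hcarrier H1. hinner H0 (K u) v = hinner H0 u w)"
    using K_props by (elim conjE)
  note K_adj = this[THEN bspec, THEN bspec]
  have "\<forall>u\<in>hcarrier H1. u \<noteq> 0 \<longrightarrow> 0 < Re (hinner H0 (K u) u)" using K_props by (elim conjE)
  note K_pos = this[rule_format]
  have K_mem: "K u \<in> hcarrier H0" if "u \<in> hcarrier H1" for u using K_ext that by auto
  have K_inner: "hinner H0 (K u) (K v) = hinner H1 u v" if "u \<in> hcarrier H1" "v \<in> hcarrier H1" for u v
    using L0.isometry_preserves_inner[OF L1.pre_hilbert_axioms _ K_lin _ that] K_iso K_mem by blast
  have eigen: "K (delta k) = complex_of_real (m k) *\<^sub>C delta k" for k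
  proof -
    \<comment> \<open>f is the component of K e beyond the expected m e; it would be an eigenvector for - m.\<close>
    let ?e = "delta k" and ?m = "complex_of_real (m k)"
    have "hinner H0 (K u) (K ?e) = hinner H0 u (?m\<^sup>2 *\<^sub>C ?e)" if u: "u \<in> hcarrier H1" for u
    proof -
      have "hinner H0 (K u) (K ?e) = (complex_of_real (w1 k))\<^sup>2 * u k"
        using K_inner[OF u, of ?e] by (simp add: weighted_l2_inner_delta)
      also have "complex_of_real (w1 k) = complex_of_real (w0 k) * ?m"
        by (simp add: w0_m flip: of_real_mult)
      also have "(complex_of_real (w0 k) * ?m)\<^sup>2 * u k = ?m\<^sup>2 * hinner H0 u ?e"
        by (simp add: weighted_l2_inner_delta power_mult_distrib)
      also have "\<dots> = hinner H0 u (?m\<^sup>2 *\<^sub>C ?e)"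
        using L0.inner_scale_right[of u ?e "?m\<^sup>2"] embedding(1)[OF u] by simp
      finally show ?thesis .
    qed
    then have Ke: "K ?e \<in> hcarrier H1" and KKe: "K (K ?e) = ?m\<^sup>2 *\<^sub>C ?e"
      using K_adj[of "K ?e" "?m\<^sup>2 *\<^sub>C ?e"] K_mem[of ?e] by auto
    define f where "f = K ?e + (- ?m) *\<^sub>C ?e"
    have f: "f \<in> hcarrier H1" unfolding f_def using Ke by (intro L1.add_mem L1.scale_mem) auto
    have "K f = K (K ?e) + (- ?m) *\<^sub>C K ?e"
    proof -
      have "(- ?m) *\<^sub>C ?e \<in> hcarrier H1" by (intro L1.scale_mem) simp
      then have "K f = K (K ?e) + K ((- ?m) *\<^sub>C ?e)"
        unfolding f_def using Ke K_lin by (simp only: linear_on_def)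
      then show ?thesis using K_lin delta_mem[of k w1] by (simp only: linear_on_def)
    qed
    also have "\<dots> = (- ?m) *\<^sub>C f"
      by (simp add: KKe f_def fun_eq_iff power2_eq_square algebra_simps del: complex_vector.scale_minus_left)
    finally have "hinner H0 (K f) f = (- ?m) * hinner H0 f f"
      using L0.inner_scale_left[of f f "- ?m"] embedding(1)[OF f] by (simp only:)
    then have "Re (hinner H0 (K f) f) = - m k * Re (hinner H0 f f)" by simp
    also have "\<dots> \<le> 0"
      using L0.inner_self_ge_0[OF embedding(1)[OF f]] m_pos[of k] by simp
    finally have "f = 0" using K_pos[OF f] by fastforce
    then show ?thesis by (simp add: f_def)
  qed
  have "K u = J u" if u: "u \<in> hcarrier H1" for u
  proof -
    have "K u k = complex_of_real (m k) * u k" for k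
    proof -
      have "hinner H0 (K (delta k)) u = hinner H0 (delta k) (K u)"
        using K_adj[of u "K u"] embedding(1)[OF u] K_mem[OF u] u by auto
      then have "complex_of_real (m k) * cnj (u k) = cnj (K u k)"
        using w0_pos[of k] embedding(1)[OF u]
        by (simp add: eigen L0.inner_scale_left weighted_l2_inner_delta_left)
      then show ?thesis
        by (metis complex_cnj_cnj complex_cnj_complex_of_real complex_cnj_mult)
    qed
    then show ?thesis using u by (simp add: J_def multiplication_def fun_eq_iff)
  qed
  then show "K = J"
    using K_ext J_positive_selfadjoint unfolding positive_selfadjoint_def by (metis PiE_ext)
qed

subsection \<open>The spectral resolution\<close>

definition proj :: "real set \<Rightarrow> ('i \<Rightarrow> complex) \<Rightarrow> 'i \<Rightarrow> complex"
  where "proj = (\<lambda>B\<in>sets borel. \<lambda>u\<in>hcarrier H0. \<lambda>k. if m k \<in> B then u k else 0)"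

lemma proj_apply:
  "B \<in> sets borel \<Longrightarrow> u \<in> hcarrier H0 \<Longrightarrow> proj B u = (\<lambda>k. if m k \<in> B then u k else 0)"
  by (simp add: proj_def)

lemma cutoff_mem: "u \<in> hcarrier H0 \<Longrightarrow> (\<lambda>k. if P k then u k else 0) \<in> hcarrier H0"
  by (rule L0.dominated(1)) auto

lemma orthogonal_projection_proj:
  assumes B: "B \<in> sets borel"
  shows "orthogonal_projection H0 (proj B)"
  unfolding orthogonal_projection_def
proof (intro conjI ballI)
  show "proj B \<in> hcarrier H0 \<rightarrow>\<^sub>E hcarrier H0"
    using B by (auto simp: proj_def cutoff_mem)
  show "linear_on (hcarrier H0) (proj B)"
    using B by (auto simp: linear_on_def proj_apply fun_eq_iff)
  fix u assume u: "u \<in> hcarrier H0"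
  show "proj B (proj B u) = proj B u"
    using B u by (simp add: proj_apply cutoff_mem fun_eq_iff)
  fix v assume v: "v \<in> hcarrier H0"
  show "hinner H0 (proj B u) v = hinner H0 u (proj B v)"
    using B u v by (simp add: proj_apply weighted_l2_def) (rule infsum_cong, simp)
qed

text \<open>
  Outside a finite set \<open>F\<close> of indices \<open>u\<close> is small in norm, and on \<open>F\<close> the difference vanishes as soon as
  the finitely many sets of the family that meet \<open>m ` F\<close> have been summed.
\<close>

lemma proj_countably_additive:
  assumes A: "range A \<subseteq> sets borel" "disjoint_family (A :: nat \<Rightarrow> real set)" and u: "u \<in> hcarrier H0"
  shows "(\<lambda>n. hnorm H0 (proj (\<Union>i. A i) u - (\<Sum>i<n. proj (A i) u))) \<longlonglongrightarrow> 0"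
proof (rule LIMSEQ_I)
  fix e :: real assume "0 < e"
  then obtain F where F: "finite F" "hnorm H0 (\<lambda>k. if k \<in> F then 0 else u k) < e"
    using L0.small_tail[OF u] by metis
  have A_meas: "A i \<in> sets borel" for i using A by auto
  have AU: "(\<Union>i. A i) \<in> sets borel" using A by auto
  define d where "d n = proj (\<Union>i. A i) u - (\<Sum>i<n. proj (A i) u)" for n
  have sum_eq: "(\<Sum>i<n. proj (A i) u) k = (if \<exists>i<n. m k \<in> A i then u k else 0)" for n k
  proof (induction n)
    case 0
    then show ?case by simp
  next
    case (Suc n)
    have "\<not> (\<exists>i<n. m k \<in> A i)" if "m k \<in> A n"
    proof
      assume "\<exists>i<n. m k \<in> A i"
      then obtain i where "i < n" "m k \<in> A i" by blast
      then show False using disjoint_family_onD[OF A(2), of i n] that by auto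
    qed
    then show ?case using Suc A_meas u by (auto simp: proj_apply less_Suc_eq)
  qed
  have d: "d n k = (if (\<exists>i. m k \<in> A i) \<and> \<not> (\<exists>i<n. m k \<in> A i) then u k else 0)" for n k
    using AU u by (auto simp: d_def sum_eq proj_apply)
  define idx where "idx k = (SOME i. m k \<in> A i)" for k
  have idx: "m k \<in> A (idx k)" if "\<exists>i. m k \<in> A i" for k
    unfolding idx_def using that by (rule someI_ex)
  \<comment> \<open>From N on, every index in F whose value lies in the union has been counted; the 0 covers empty F.\<close>
  define N where "N = Suc (Max (insert 0 (idx ` F)))"
  have idx_less: "idx k < N" if "k \<in> F" for k
    unfolding N_def less_Suc_eq_le using F(1) that by (intro Max_ge) auto
  have "norm (hnorm H0 (d n) - 0) < e" if n: "N \<le> n" for n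
  proof -
    have tail: "(\<lambda>k. if k \<in> F then 0 else u k) \<in> hcarrier H0"
      by (rule L0.dominated(1)[OF u]) auto
    have le: "cmod (d n k) \<le> cmod (if k \<in> F then 0 else u k)" for k
    proof (cases "k \<in> F")
      case True
      have "\<exists>i<n. m k \<in> A i" if "\<exists>i. m k \<in> A i"
        using idx[OF that] less_le_trans[OF idx_less[OF True] n] by blast
      then have "d n k = 0" unfolding d by metis
      then show ?thesis by simp
    qed (simp add: d)
    have "d n \<in> hcarrier H0" "hnorm H0 (d n) \<le> hnorm H0 (\<lambda>k. if k \<in> F then 0 else u k)"
      using L0.dominated(1)[OF tail le] L0.hnorm_dominated[OF tail le] by blast+
    then show ?thesis using F(2) L0.hnorm_nonneg[of "d n"] by simp
  qed
  then show "\<exists>N. \<forall>n\<ge>N. norm (hnorm H0 (proj (\<Union>i. A i) u - (\<Sum>i<n. proj (A i) u)) - 0) < e"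
    unfolding d_def by blast
qed

lemma projection_valued_measure_proj: "projection_valued_measure H0 proj"
  unfolding projection_valued_measure_def
proof (intro conjI ballI allI impI)
  show "proj \<in> sets borel \<rightarrow>\<^sub>E {P. orthogonal_projection H0 P}"
    using orthogonal_projection_proj by (auto simp: proj_def)
  show "proj UNIV u = u" if "u \<in> hcarrier H0" for u
    using that by (simp add: proj_apply)
  show "proj (A \<inter> B) u = proj A (proj B u)"
    if "A \<in> sets borel" "B \<in> sets borel" "u \<in> hcarrier H0" for A B u
    using that by (simp add: proj_apply cutoff_mem fun_eq_iff)
qed (rule proj_countably_additive)

sublocale E: pvm H0 proj
  by unfold_locales (rule L0.complete projection_valued_measure_proj)+

text \<open>
  The measure \<open>(E u, u)\<close> puts the mass \<open>(w0 k)\<^sup>2 \<bar>u k\<bar>\<^sup>2\<close> at the point \<open>m k\<close>. Written as an image measure,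
  it reduces spectral integrals to sums over the index set.
\<close>

lemma scalar_measure_proj:
  assumes u: "u \<in> hcarrier H0"
  shows "scalar_measure H0 proj u
    = distr (density (count_space UNIV) (\<lambda>k. ennreal ((w0 k * cmod (u k))\<^sup>2))) borel m"
proof (rule measure_eqI)
  fix B assume "B \<in> sets (scalar_measure H0 proj u)"
  then have B: "B \<in> sets borel" by simp
  let ?v = "\<lambda>k. if m k \<in> B then u k else 0"
  have v: "?v \<in> hcarrier H0" using u by (rule cutoff_mem)
  have "emeasure (distr (density (count_space UNIV) (\<lambda>k. ennreal ((w0 k * cmod (u k))\<^sup>2))) borel m) B
      = (\<integral>\<^sup>+k. ennreal ((w0 k * cmod (u k))\<^sup>2) * indicator (m -` B) k \<partial>count_space UNIV)"
    using B by (simp add: emeasure_distr emeasure_density)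
  also have "\<dots> = (\<integral>\<^sup>+k. ennreal ((w0 k * cmod (?v k))\<^sup>2) \<partial>count_space UNIV)"
    by (intro nn_integral_cong) (auto simp: indicator_def)
  also have "\<dots> = ennreal (\<integral>k. (w0 k * cmod (?v k))\<^sup>2 \<partial>count_space UNIV)"
    using v by (intro nn_integral_eq_integral) (simp_all add: weighted_l2_mem_iff)
  also have "\<dots> = ennreal ((hnorm H0 ?v)\<^sup>2)"
    using v by (simp only: weighted_l2_hnorm_sq)
  also have "\<dots> = emeasure (scalar_measure H0 proj u) B"
    using u B by (simp add: E.emeasure_scalar_measure proj_apply)
  finally show "emeasure (scalar_measure H0 proj u) B
    = emeasure (distr (density (count_space UNIV) (\<lambda>k. ennreal ((w0 k * cmod (u k))\<^sup>2))) borel m) B" ..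
qed simp

lemma
  fixes f :: "real \<Rightarrow> real"
  assumes u: "u \<in> hcarrier H0" and f: "f \<in> borel_measurable borel"
  shows integrable_scalar_measure_proj: "integrable (scalar_measure H0 proj u) f
      \<longleftrightarrow> integrable (count_space UNIV) (\<lambda>k. (w0 k * cmod (u k))\<^sup>2 * f (m k))"
    and integral_scalar_measure_proj: "(\<integral>t. f t \<partial>scalar_measure H0 proj u)
      = (\<integral>k. (w0 k * cmod (u k))\<^sup>2 * f (m k) \<partial>count_space UNIV)"
  unfolding scalar_measure_proj[OF u]
  using f by (simp_all add: integrable_distr_eq integral_distr integrable_density integral_density)

lemma spectral_integral_dom_proj:
  assumes f: "f \<in> borel_measurable borel"
  shows "spectral_integral_dom H0 proj f = hcarrier H0 \<inter> hcarrier (weighted_l2 (\<lambda>k. w0 k * f (m k)))"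
  using f
  by (auto simp: spectral_integral_dom_def integrable_scalar_measure_proj weighted_l2_mem_iff
      power_mult_distrib mult_ac)

lemma spectral_integral_proj:
  assumes f: "f \<in> borel_measurable borel"
    and D: "hcarrier (weighted_l2 (\<lambda>k. w0 k * f (m k))) \<subseteq> hcarrier H0" "\<And>k. 0 < f (m k)"
  shows "spectral_integral H0 proj f
    = (\<lambda>u\<in>hcarrier (weighted_l2 (\<lambda>k. w0 k * f (m k))). multiplication (\<lambda>k. f (m k)) u)"
proof (rule L0.spectral_integral_eqI)
  let ?D = "hcarrier (weighted_l2 (\<lambda>k. w0 k * f (m k)))"
  let ?A = "\<lambda>u\<in>?D. multiplication (\<lambda>k. f (m k)) u"
  interpret P: positive_weight "\<lambda>k. w0 k * f (m k)"
    by unfold_locales (simp add: w0_pos D)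
  show "spectral_integral_dom H0 proj f = ?D"
    using D by (auto simp: spectral_integral_dom_proj[OF f])
  show "complex_vector.subspace ?D" by (rule P.subspace)
  show "L0.mtopology closure_of ?D = hcarrier H0"
    using D(1) finite_support_mem by (intro L0.dense_superset[OF L0.finite_support_dense]) auto
  show "?A \<in> ?D \<rightarrow>\<^sub>E hcarrier H0" by (auto simp: multiplication_mem_iff)
  show "linear_on ?D ?A"
    using linear_multiplication[of ?D "\<lambda>k. f (m k)"] by (simp add: linear_on_def)
  fix u assume u: "u \<in> ?D"
  then have uH: "u \<in> hcarrier H0" using D by auto
  have mu: "multiplication (\<lambda>k. f (m k)) u \<in> hcarrier H0" using u by (simp add: multiplication_mem_iff)
  have "(complex_of_real (w0 k))\<^sup>2 * multiplication (\<lambda>k. f (m k)) u k * cnj (u k)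
      = complex_of_real ((w0 k * cmod (u k))\<^sup>2 * f (m k))" for k
    using complex_norm_square[of "u k"]
    by (simp add: multiplication_def power_mult_distrib mult_ac)
  then show "hinner H0 (?A u) u = complex_of_real (\<integral>t. f t \<partial>scalar_measure H0 proj u)"
    using u uH mu
    by (simp add: weighted_l2_inner integral_scalar_measure_proj[OF uH f]
        del: of_real_mult of_real_power)
qed

text \<open>
  Let \<open>E'\<close> be another resolution of the identity for \<open>J\<close> and \<open>e\<close> a unit vector with eigenvalue \<open>m k\<close>.
  The first two moments of the measure \<open>(E'e, e)\<close> are \<open>m k\<close> and \<open>(m k)\<^sup>2\<close> times its mass, so its
  variance about \<open>m k\<close> vanishes and it sits at the point \<open>m k\<close>. This determines \<open>E' e\<close>.
\<close>

lemma spectral_resolution_eq: "spectral_resolution H0 (hcarrier H1) J = proj"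
  unfolding spectral_resolution_def
proof (rule the_equality)
  have "hcarrier (weighted_l2 (\<lambda>k. w0 k * m k)) = hcarrier H1" by (simp add: w0_m)
  moreover have sub: "hcarrier H1 \<subseteq> hcarrier H0" using embedding by auto
  ultimately show "projection_valued_measure H0 proj \<and>
      spectral_integral_dom H0 proj (\<lambda>t. t) = hcarrier H1 \<and> spectral_integral H0 proj (\<lambda>t. t) = J"
    using projection_valued_measure_proj spectral_integral_dom_proj[of "\<lambda>t. t"]
      spectral_integral_proj[of "\<lambda>t. t"] m_pos by (auto simp: J_def)
next
  fix E'
  assume E': "projection_valued_measure H0 E' \<and>
      spectral_integral_dom H0 E' (\<lambda>t. t) = hcarrier H1 \<and> spectral_integral H0 E' (\<lambda>t. t) = J"
  interpret E': pvm H0 E'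
    by unfold_locales (use L0.complete E' in auto)
  have moments: "hinner H0 (J u) u = complex_of_real (\<integral>t. t \<partial>scalar_measure H0 E' u)"
      "(hnorm H0 (J u))\<^sup>2 = (\<integral>t. t\<^sup>2 \<partial>scalar_measure H0 E' u)"
      "integrable (scalar_measure H0 E' u) (\<lambda>t. t\<^sup>2)"
    if u: "u \<in> hcarrier H1" for u
    using E'.spectral_integral_properties[of "\<lambda>t. t" "hcarrier H1" u] E' u L1.subspace H1_dense
    by (auto simp: spectral_integral_dom_def)
  have eigen: "E' B (delta k) = (if m k \<in> B then delta k else 0)" if B: "B \<in> sets borel" for B k
  proof -
    let ?e = "delta k :: 'i \<Rightarrow> complex" and ?\<mu> = "scalar_measure H0 E' (delta k)"
    interpret finite_measure ?\<mu> by (rule E'.finite_scalar_measure) simp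
    define n where "n = (hnorm H0 ?e)\<^sup>2"
    note Je = J_delta[of k]
    have "hinner H0 (J ?e) ?e = complex_of_real (m k * n)"
      unfolding Je n_def using L0.inner_scale_left[of ?e ?e "complex_of_real (m k)"] L0.inner_self[of ?e] by simp
    then have first: "(\<integral>t. t \<partial>?\<mu>) = m k * n"
      using moments(1)[of ?e] by (simp del: of_real_mult)
    have "(hnorm H0 (J ?e))\<^sup>2 = (m k)\<^sup>2 * n"
      unfolding Je n_def using L0.hnorm_scale[of ?e "complex_of_real (m k)"] by (simp add: power_mult_distrib)
    then have second: "(\<integral>t. t\<^sup>2 \<partial>?\<mu>) = (m k)\<^sup>2 * n" using moments(2)[of ?e] by simp
    have int2: "integrable ?\<mu> (\<lambda>t. t\<^sup>2)" using moments(3)[of ?e] by simp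
    have int1: "integrable ?\<mu> (\<lambda>t. t)"
      by (rule square_integrable_imp_integrable) (use int2 in simp_all)
    have mass: "measure ?\<mu> UNIV = n"
      by (simp add: n_def E'.measure_scalar_measure E'.proj_UNIV)
    \<comment> \<open>The variance of the measure about m k vanishes.\<close>
    have expand: "(\<lambda>t. (t - m k)\<^sup>2) = (\<lambda>t. t\<^sup>2 - 2 * m k * t + (m k)\<^sup>2)"
      by (simp add: fun_eq_iff power2_diff)
    have int: "integrable ?\<mu> (\<lambda>t. (t - m k)\<^sup>2)"
      unfolding expand using int1 int2 by simp
    have "(\<integral>t. (t - m k)\<^sup>2 \<partial>?\<mu>) = (m k)\<^sup>2 * n - 2 * m k * (m k * n) + (m k)\<^sup>2 * n"
      unfolding expand using int1 int2 by (simp add: first second mass)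
    also have "\<dots> = 0" by (simp add: power2_eq_square)
    finally have ae: "AE t in ?\<mu>. t = m k"
      using integral_nonneg_eq_0_iff_AE[OF int] by simp
    have zero: "E' C ?e = 0" if C: "C \<in> sets borel" "m k \<notin> C" for C
    proof -
      have "AE t in ?\<mu>. t \<notin> C" using ae C by (auto elim!: eventually_mono)
      then have "emeasure ?\<mu> C = 0"
        using C by (subst (asm) AE_iff_measurable[of C]) auto
      then have "(hnorm H0 (E' C ?e))\<^sup>2 = 0"
        using C by (simp add: E'.emeasure_scalar_measure)
      then show ?thesis using C by simp
    qed
    show ?thesis
    proof (cases "m k \<in> B")
      case True
      have "E' (\<Union>p\<in>{B, - B}. p) ?e = (\<Sum>p\<in>{B, - B}. E' p ?e)"
        by (rule E'.proj_sum_partition) (use B in \<open>auto simp: disjoint_family_on_def\<close>)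
      moreover have "B \<noteq> - B" by auto
      ultimately have "?e = E' B ?e"
        using zero[of "- B"] B True by (simp add: E'.proj_UNIV)
      then show ?thesis using True by simp
    qed (use zero B in simp)
  qed
  have eq: "E' B u = proj B u" if B: "B \<in> sets borel" and u: "u \<in> hcarrier H0" for B u
  proof
    fix k
    have "hinner H0 (E' B u) (delta k) = hinner H0 u (E' B (delta k))"
      using B u by (simp add: E'.proj_symmetric)
    then show "E' B u k = proj B u k"
      using w0_pos[of k] u B
      by (auto simp: eigen weighted_l2_inner_delta proj_apply split: if_splits)
  qed
  have E'_ext: "E' \<in> sets borel \<rightarrow>\<^sub>E {P. orthogonal_projection H0 P}"
    using E' by (simp add: projection_valued_measure_def)
  have proj_ext: "proj \<in> sets borel \<rightarrow>\<^sub>E {P. orthogonal_projection H0 P}"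
    using projection_valued_measure_proj by (simp add: projection_valued_measure_def)
  show "E' = proj"
  proof (rule PiE_ext[OF E'_ext proj_ext])
    fix B :: "real set" assume B: "B \<in> sets borel"
    have ext: "E' B \<in> hcarrier H0 \<rightarrow>\<^sub>E hcarrier H0" "proj B \<in> hcarrier H0 \<rightarrow>\<^sub>E hcarrier H0"
      using E'.proj[OF B] orthogonal_projection_proj[OF B] by (simp_all add: orthogonal_projection_def)
    show "E' B = proj B" by (rule PiE_ext[OF ext]) (rule eq[OF B])
  qed
qed

subsection \<open>The interpolation space\<close>

text \<open>
  Since \<open>m \<ge> r\<close>, the boundedness of \<open>1 / \<psi>\<close> away from 0 puts the weighted space inside \<open>H0\<close>, and the
  value 0 of the extended \<open>\<psi>\<close> on the nonpositive half-line is never attained.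
\<close>

theorem interpolation_space_weighted:
  assumes \<psi>: "\<psi> \<in> class_B"
  shows "hcarrier (interpolation_space H0 H1 \<psi>) = hcarrier (weighted_l2 (\<lambda>k. w0 k * \<psi> (m k)))"
    and "u \<in> hcarrier (weighted_l2 (\<lambda>k. w0 k * \<psi> (m k))) \<Longrightarrow>
      hnorm (interpolation_space H0 H1 \<psi>) u = hnorm (weighted_l2 (\<lambda>k. w0 k * \<psi> (m k))) u"
proof -
  let ?W = "weighted_l2 (\<lambda>k. w0 k * \<psi> (m k))"
  define f where "f t = (if 0 < t then \<psi> t else 0)" for t
  have fm: "f (m k) = \<psi> (m k)" for k using m_pos by (simp add: f_def)
  have \<psi>_pos: "0 < \<psi> (m k)" for k using \<psi> m_pos by (simp add: class_B_def)
  have f: "f \<in> borel_measurable borel"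
  proof -
    have "(\<lambda>t. indicator {0<..} t *\<^sub>R \<psi> t) \<in> borel_measurable borel"
      using \<psi> borel_measurable_restrict_space_iff[of "{0<..}" borel \<psi>] by (simp add: class_B_def)
    moreover have "f = (\<lambda>t. indicator {0<..} t *\<^sub>R \<psi> t)"
      by (auto simp: f_def fun_eq_iff)
    ultimately show ?thesis by simp
  qed
  have "bounded ((\<lambda>t. 1 / \<psi> t) ` {r/2<..})" using \<psi> r_pos by (simp add: class_B_def)
  then obtain b where b: "\<And>t. r / 2 < t \<Longrightarrow> \<bar>1 / \<psi> t\<bar> \<le> b"
    unfolding bounded_iff by force
  have sub: "hcarrier ?W \<subseteq> hcarrier H0"
  proof
    fix u assume u: "u \<in> hcarrier ?W"
    have b': "1 / \<psi> (m k) \<le> b" for k using b[of "m k"] m_ge[of k] r_pos by linarith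
    have le: "\<bar>w0 k\<bar> \<le> b * \<bar>w0 k * \<psi> (m k)\<bar>" for k
      using b'[of k] \<psi>_pos[of k] w0_pos[of k] by (simp add: abs_mult field_simps)
    have "0 \<le> 1 / \<psi> (m undefined)" using \<psi>_pos by (simp add: less_imp_le)
    then have "0 \<le> b" using b' order_trans by blast
    then show "u \<in> hcarrier H0" using weighted_l2_mono(1)[OF le _ u] by simp
  qed
  have dom: "spectral_integral_dom H0 proj f = hcarrier ?W"
    using sub by (auto simp: spectral_integral_dom_proj[OF f] fm)
  have int: "spectral_integral H0 proj f = (\<lambda>u\<in>hcarrier ?W. multiplication (\<lambda>k. \<psi> (m k)) u)"
    using spectral_integral_proj[OF f] sub \<psi>_pos by (simp add: fm)
  have eq: "interpolation_space H0 H1 \<psi> = \<lparr>hcarrier = hcarrier ?W,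
      hinner = (\<lambda>u v. hinner H0 (spectral_integral H0 proj f u) (spectral_integral H0 proj f v))\<rparr>"
    unfolding interpolation_space_def Let_def generating_operator_eq spectral_resolution_eq
    unfolding f_def[symmetric] dom ..
  show "hcarrier (interpolation_space H0 H1 \<psi>) = hcarrier ?W" by (simp add: eq)
  show "hnorm (interpolation_space H0 H1 \<psi>) u = hnorm ?W u" if "u \<in> hcarrier ?W"
    using that by (simp add: eq hnorm_def int inner_multiplication)
qed

end

section \<open>Interpolation parameters on comparable arguments\<close>

lemma hnorm_delta: "hnorm (weighted_l2 w) (delta k) = \<bar>w k\<bar>"
proof -
  have "hinner (weighted_l2 w) (delta k) (delta k) = complex_of_real ((w k)\<^sup>2)"
    by (simp add: weighted_l2_inner_delta) (simp add: delta_def)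
  then show ?thesis by (simp add: hnorm_def del: of_real_power)
qed

lemma
  assumes g: "bij g"
  shows weighted_l2_reindex_mem:
      "u \<circ> g \<in> hcarrier (weighted_l2 (w \<circ> g)) \<longleftrightarrow> u \<in> hcarrier (weighted_l2 w)"
    and weighted_l2_reindex_hnorm:
      "hnorm (weighted_l2 (w \<circ> g)) (u \<circ> g) = hnorm (weighted_l2 w) u"
proof -
  show "u \<circ> g \<in> hcarrier (weighted_l2 (w \<circ> g)) \<longleftrightarrow> u \<in> hcarrier (weighted_l2 w)"
    using summable_on_reindex_bij_betw[of g UNIV UNIV "\<lambda>k. (w k * cmod (u k))\<^sup>2"] g
    by (simp add: weighted_l2_mem_iff_summable)
  show "hnorm (weighted_l2 (w \<circ> g)) (u \<circ> g) = hnorm (weighted_l2 w) u"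
    using infsum_reindex_bij_betw[of g UNIV UNIV "\<lambda>k. (complex_of_real (w k))\<^sup>2 * u k * cnj (u k)"] g
    by (simp add: hnorm_def weighted_l2_def)
qed

text \<open>
  An involution of the index set carries the weighted space to the one with the permuted weight,
  isometrically; boundedness then only asks for the two weights to be comparable.
\<close>

lemma bounded_operator_reindex:
  fixes w :: "'i \<Rightarrow> real"
  assumes g: "\<And>k. g (g k) = k" and w: "\<And>k. \<bar>w (g k)\<bar> \<le> c * \<bar>w k\<bar>" and c: "0 \<le> c"
  shows "bounded_operator (weighted_l2 w) (weighted_l2 w) (\<lambda>u. u \<circ> g)"
  unfolding bounded_operator_def
proof (intro conjI exI[of _ c] ballI)
  have bij: "bij g" using g by (metis bijI')
  have gg: "(w \<circ> g) \<circ> g = w" by (simp add: fun_eq_iff g)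
  have le: "\<bar>(w \<circ> g) k\<bar> \<le> c * \<bar>w k\<bar>" for k using w by simp
  note mono = weighted_l2_mono[where w = "w \<circ> g" and w' = w, OF le c]
  show "(\<lambda>u. u \<circ> g) \<in> hcarrier (weighted_l2 w) \<rightarrow> hcarrier (weighted_l2 w)"
    using mono(1) weighted_l2_reindex_mem[OF bij, of _ "w \<circ> g"] by (auto simp: gg)
  show "linear_on (hcarrier (weighted_l2 w)) (\<lambda>u. u \<circ> g)"
    by (simp add: linear_on_def fun_eq_iff)
  fix u assume u: "u \<in> hcarrier (weighted_l2 w)"
  show "hnorm (weighted_l2 w) (u \<circ> g) \<le> c * hnorm (weighted_l2 w) u"
    using mono(2)[OF u] weighted_l2_reindex_hnorm[OF bij, of "w \<circ> g" u] by (simp add: gg)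
qed

text \<open>
  Suppose that for each \<open>j\<close> some comparable pair \<open>(s, t)\<close> violates the estimate with constant \<open>j\<close>. Take the
  constant weight 1 and the weight \<open>w\<close> with values \<open>s\<close> at \<open>2 j\<close> and \<open>t\<close> at \<open>2 j + 1\<close>. The operator that
  exchanges the coordinates \<open>2 j\<close> and \<open>2 j + 1\<close> is bounded for both weights, hence for the weight \<open>\<psi>(w)\<close>, and
  on the unit vectors its boundedness reads \<open>\<psi>(t) \<le> C \<psi>(s)\<close> with one \<open>C\<close> for all \<open>j\<close>.
\<close>

lemma interpolation_parameter_comparable:
  assumes \<psi>: "interpolation_parameter \<psi>" and r: "0 < r" and c: "1 \<le> c"
  obtains C where "1 \<le> C"
    "\<And>s t. r \<le> s \<Longrightarrow> r \<le> t \<Longrightarrow> t \<le> c * s \<Longrightarrow> s \<le> c * t \<Longrightarrow> \<psi> t \<le> C * \<psi> s"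
proof -
  have \<psi>B: "\<psi> \<in> class_B" using \<psi> by (simp add: interpolation_parameter_def)
  then have \<psi>_pos: "0 < \<psi> t" if "0 < t" for t using that by (simp add: class_B_def)
  have "\<exists>C. \<forall>s t. r \<le> s \<longrightarrow> r \<le> t \<longrightarrow> t \<le> c * s \<longrightarrow> s \<le> c * t \<longrightarrow> \<psi> t \<le> C * \<psi> s"
  proof (rule ccontr)
    assume "\<not> ?thesis"
    then have "\<forall>j::nat. \<exists>p. r \<le> fst p \<and> r \<le> snd p \<and> snd p \<le> c * fst p \<and> fst p \<le> c * snd p
        \<and> real j * \<psi> (fst p) < \<psi> (snd p)"
      by (simp add: not_le)
    from choice[OF this] obtain p where p: "\<And>j::nat. r \<le> fst (p j)" "\<And>j. r \<le> snd (p j)"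
        "\<And>j. snd (p j) \<le> c * fst (p j)" "\<And>j. fst (p j) \<le> c * snd (p j)"
        "\<And>j. real j * \<psi> (fst (p j)) < \<psi> (snd (p j))" by blast
    define w where "w k = (if even k then fst (p (k div 2)) else snd (p (k div 2)))" for k :: nat
    define g where "g k = (if even k then k + 1 else k - 1)" for k :: nat
    define T where "T u = u \<circ> g" for u :: "nat \<Rightarrow> complex"
    have gg: "g (g k) = k" for k by (simp add: g_def)
    have w_ge: "r \<le> w k" for k using p by (simp add: w_def)
    have w_g: "w (g k) \<le> c * w k" for k
      using p(3,4) by (auto simp: w_def g_def elim!: oddE)
    interpret weight_pair "\<lambda>_. 1" w r
      by unfold_locales (use r w_ge in auto)
    have m_eq: "m k = w k" for k by (simp add: m_def)
    have "bounded_operator H0 H0 T"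
      unfolding T_def by (rule bounded_operator_reindex[where c = 1]) (simp_all add: gg)
    moreover have "bounded_operator H1 H1 T"
      unfolding T_def by (rule bounded_operator_reindex[where c = c])
        (use c w_g w1_pos in \<open>simp_all add: gg less_imp_le\<close>)
    ultimately have "bounded_operator (interpolation_space H0 H1 \<psi>) (interpolation_space H0 H1 \<psi>) T"
      using \<psi> admissible unfolding interpolation_parameter_def by blast
    then obtain C where C: "\<And>u. u \<in> hcarrier (interpolation_space H0 H1 \<psi>) \<Longrightarrow>
        hnorm (interpolation_space H0 H1 \<psi>) (T u) \<le> C * hnorm (interpolation_space H0 H1 \<psi>) u"
      by (auto simp: bounded_operator_def)
    have main: "\<psi> (snd (p j)) \<le> C * \<psi> (fst (p j))" for j
    proof -
      have "g k = 2 * j \<longleftrightarrow> k = 2 * j + 1" for k using gg by (metis add_diff_cancel_right' dvd_triv_left even_plus_one_iff g_def)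
      then have T: "T (delta (2 * j)) = delta (2 * j + 1)"
        by (simp add: T_def delta_def fun_eq_iff)
      have "hnorm (interpolation_space H0 H1 \<psi>) (delta k) = \<psi> (w k)" for k
        using interpolation_space_weighted(2)[OF \<psi>B delta_mem, of k] \<psi>_pos[OF w1_pos[of k]]
        by (simp add: hnorm_delta m_eq)
      then show ?thesis
        using C[of "delta (2 * j)"] interpolation_space_weighted(1)[OF \<psi>B]
        by (simp add: T w_def)
    qed
    obtain j :: nat where "C < real j" using reals_Archimedean2 by blast
    then have "C * \<psi> (fst (p j)) < real j * \<psi> (fst (p j))"
      using \<psi>_pos[of "fst (p j)"] p(1)[of j] r by simp
    then show False using main[of j] p(5)[of j] by linarith
  qed
  then obtain C where C: "\<And>s t. r \<le> s \<Longrightarrow> r \<le> t \<Longrightarrow> t \<le> c * s \<Longrightarrow> s \<le> c * t \<Longrightarrow> \<psi> t \<le> C * \<psi> s"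
    by blast
  show ?thesis
  proof (rule that[of "max 1 C"])
    fix s t assume st: "r \<le> s" "r \<le> t" "t \<le> c * s" "s \<le> c * t"
    have "\<psi> t \<le> C * \<psi> s" by (rule C[OF st])
    also have "\<dots> \<le> max 1 C * \<psi> s"
      using \<psi>_pos[of s] st(1) r by (intro mult_right_mono) auto
    finally show "\<psi> t \<le> max 1 C * \<psi> s" .
  qed simp
qed

section \<open>Functions of RO-variation\<close>

lemma RO_pos: "\<phi> \<in> RO \<Longrightarrow> 1 \<le> t \<Longrightarrow> 0 < \<phi> t"
  by (simp add: RO_def)

lemma RO_step:
  assumes \<phi>: "\<phi> \<in> RO"
  obtains a c where "1 < a" "1 \<le> c"
    "\<And>s t. 1 \<le> t \<Longrightarrow> 1 \<le> s \<Longrightarrow> s \<le> a \<Longrightarrow> \<phi> (s * t) \<le> c * \<phi> t"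
    "\<And>s t. 1 \<le> t \<Longrightarrow> 1 \<le> s \<Longrightarrow> s \<le> a \<Longrightarrow> \<phi> t \<le> c * \<phi> (s * t)"
proof -
  obtain a c where ac: "1 < a" "1 \<le> c"
      and *: "\<And>s t. 1 \<le> t \<Longrightarrow> s \<in> {1..a} \<Longrightarrow> 1 / c \<le> \<phi> (s * t) / \<phi> t \<and> \<phi> (s * t) / \<phi> t \<le> c"
    using \<phi> unfolding RO_def by blast
  show ?thesis
  proof (rule that[OF ac])
    fix s t :: real assume t: "1 \<le> t" and s: "1 \<le> s" "s \<le> a"
    have "1 / c \<le> \<phi> (s * t) / \<phi> t" "\<phi> (s * t) / \<phi> t \<le> c" using *[of t s] t s by auto
    then show "\<phi> (s * t) \<le> c * \<phi> t" "\<phi> t \<le> c * \<phi> (s * t)"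
      using RO_pos[OF \<phi> t] ac by (simp_all add: field_simps)
  qed
qed

lemma RO_iterate:
  assumes \<phi>: "\<phi> \<in> RO"
  obtains a c where "1 < a" "1 \<le> c"
    "\<And>n t. 1 \<le> t \<Longrightarrow> t \<le> a ^ n \<Longrightarrow> \<phi> t \<le> c ^ n * \<phi> 1"
    "\<And>n t. 1 \<le> t \<Longrightarrow> t \<le> a ^ n \<Longrightarrow> \<phi> 1 \<le> c ^ n * \<phi> t"
proof -
  obtain a c where ac: "1 < a" "1 \<le> c"
    and up: "\<And>s t. 1 \<le> t \<Longrightarrow> 1 \<le> s \<Longrightarrow> s \<le> a \<Longrightarrow> \<phi> (s * t) \<le> c * \<phi> t"
    and low: "\<And>s t. 1 \<le> t \<Longrightarrow> 1 \<le> s \<Longrightarrow> s \<le> a \<Longrightarrow> \<phi> t \<le> c * \<phi> (s * t)"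
    using RO_step[OF \<phi>] by blast
  have "\<phi> t \<le> c ^ n * \<phi> 1 \<and> \<phi> 1 \<le> c ^ n * \<phi> t" if "1 \<le> t" "t \<le> a ^ n" for n t
    using that
  proof (induction n arbitrary: t)
    case 0
    then have "t = 1" by simp
    then show ?case by simp
  next
    case (Suc n)
    \<comment> \<open>One step of size s, the largest allowed towards t, is split off; the rest t' is covered by n steps.\<close>
    define s where "s = min t a"
    define t' where "t' = t / s"
    have s: "1 \<le> s" "s \<le> a" using Suc.prems ac by (auto simp: s_def)
    have t: "t = s * t'" using s by (simp add: t'_def)
    have t1: "1 \<le> t'" using s Suc.prems by (simp add: t'_def s_def)
    have "t' \<le> a ^ n"
    proof (cases "t \<le> a")
      case True
      then show ?thesis using ac Suc.prems by (simp add: t'_def s_def one_le_power)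
    next
      case False
      then show ?thesis using ac Suc.prems by (simp add: t'_def s_def divide_simps mult.commute)
    qed
    note IH = Suc.IH[OF t1 this]
    have "\<phi> t \<le> c * \<phi> t'" "\<phi> t' \<le> c * \<phi> t" using up[OF t1 s] low[OF t1 s] t by simp_all
    moreover have "c * \<phi> t' \<le> c * (c ^ n * \<phi> 1)" "c ^ n * \<phi> t' \<le> c ^ n * (c * \<phi> t)"
      using IH ac calculation by (auto intro!: mult_left_mono)
    ultimately show ?case using IH by (auto simp: mult_ac)
  qed
  then show ?thesis using that[OF ac] by blast
qed

text \<open>
  If \<open>a ^ l \<le> t \<le> a ^ (l + 1)\<close>, then \<open>l + 1\<close> steps lead from 1 to \<open>t\<close> and cost the factor
  \<open>c * c ^ l\<close>, which is at most \<open>c * t ^ N\<close> once \<open>c \<le> a ^ N\<close>.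
\<close>

lemma RO_polynomial_lower_bound:
  assumes \<phi>: "\<phi> \<in> RO"
  obtains C N where "0 < C" "\<And>t. 1 \<le> t \<Longrightarrow> 1 \<le> C * t ^ N * \<phi> t"
proof -
  obtain a c where ac: "1 < a" "1 \<le> c"
    and low: "\<And>n t. 1 \<le> t \<Longrightarrow> t \<le> a ^ n \<Longrightarrow> \<phi> 1 \<le> c ^ n * \<phi> t"
    using RO_iterate[OF \<phi>] by metis
  obtain N where N: "c < a ^ N" using real_arch_pow[OF ac(1)] by blast
  show ?thesis
  proof (rule that[of "c / \<phi> 1" N])
    show "0 < c / \<phi> 1" using ac RO_pos[OF \<phi>, of 1] by simp
    fix t :: real assume t: "1 \<le> t"
    have ex: "\<exists>n. t \<le> a ^ n" using real_arch_pow[OF ac(1), of t] less_imp_le by blast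
    define n where "n = (LEAST n. t \<le> a ^ n)"
    have n: "t \<le> a ^ n" unfolding n_def using ex by (rule LeastI_ex)
    have "c ^ n \<le> c * t ^ N"
    proof (cases n)
      case 0
      have "1 * 1 \<le> c * t ^ N" using ac t by (intro mult_mono) (auto simp: one_le_power)
      then show ?thesis using 0 by simp
    next
      case (Suc l)
      then have "\<not> t \<le> a ^ l" using not_less_Least[of l "\<lambda>n. t \<le> a ^ n"] by (simp add: n_def)
      then have l: "a ^ l \<le> t" by simp
      have "c ^ l \<le> (a ^ N) ^ l" using N ac by (intro power_mono) auto
      also have "\<dots> = (a ^ l) ^ N" by (simp add: power_mult[symmetric] mult.commute)
      also have "\<dots> \<le> t ^ N" using l ac by (intro power_mono) auto
      finally show ?thesis using Suc ac by simp
    qed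
    then have "c ^ n * \<phi> t \<le> c * t ^ N * \<phi> t"
      using RO_pos[OF \<phi> t] by simp
    then have "\<phi> 1 \<le> c * t ^ N * \<phi> t" using low[OF t n] by linarith
    then show "1 \<le> c / \<phi> 1 * t ^ N * \<phi> t" using RO_pos[OF \<phi>, of 1] by (simp add: field_simps)
  qed
qed

text \<open>
  The assumption gives the estimate for large \<open>t\<close>. On the remaining compact interval finitely many steps
  from 1 bound \<open>\<phi>0\<close> from above and \<open>\<phi>1\<close> from below.
\<close>

lemma RO_ratio_lower_bound:
  assumes \<phi>0: "\<phi>0 \<in> RO" and \<phi>1: "\<phi>1 \<in> RO" and bdd: "Bfun (\<lambda>t. \<phi>0 t / \<phi>1 t) at_top"
  obtains r where "0 < r" "\<And>t. 1 \<le> t \<Longrightarrow> r * \<phi>0 t \<le> \<phi>1 t"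
proof -
  obtain K where K: "0 < K" "\<forall>\<^sub>F t in at_top. norm (\<phi>0 t / \<phi>1 t) \<le> K"
    using bdd by (rule BfunE)
  then obtain b where b: "\<And>t. b \<le> t \<Longrightarrow> norm (\<phi>0 t / \<phi>1 t) \<le> K"
    by (auto simp: eventually_at_top_linorder)
  obtain a0 c0 where ac0: "1 < a0" "1 \<le> c0"
    and up: "\<And>n t. 1 \<le> t \<Longrightarrow> t \<le> a0 ^ n \<Longrightarrow> \<phi>0 t \<le> c0 ^ n * \<phi>0 1"
    using RO_iterate[OF \<phi>0] by metis
  obtain a1 c1 where ac1: "1 < a1" "1 \<le> c1"
    and low: "\<And>n t. 1 \<le> t \<Longrightarrow> t \<le> a1 ^ n \<Longrightarrow> \<phi>1 1 \<le> c1 ^ n * \<phi>1 t"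
    using RO_iterate[OF \<phi>1] by metis
  obtain n0 where n0: "b < a0 ^ n0" using real_arch_pow[OF ac0(1)] by blast
  obtain n1 where n1: "b < a1 ^ n1" using real_arch_pow[OF ac1(1)] by blast
  note pos = RO_pos[OF \<phi>0] RO_pos[OF \<phi>1]
  define M where "M = c0 ^ n0 * \<phi>0 1 * (c1 ^ n1 / \<phi>1 1)"
  have M: "0 < M" using ac0 ac1 pos[of 1] by (simp add: M_def)
  have le: "\<phi>0 t \<le> max K M * \<phi>1 t" if t: "1 \<le> t" for t
  proof (cases "b \<le> t")
    case True
    have "\<phi>0 t \<le> K * \<phi>1 t" using b[OF True] pos[OF t] by (simp add: field_simps)
    also have "\<dots> \<le> max K M * \<phi>1 t" using pos[OF t] by (intro mult_right_mono) auto
    finally show ?thesis .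
  next
    case False
    have "\<phi>0 t \<le> c0 ^ n0 * \<phi>0 1" using up[OF t, of n0] n0 False by linarith
    also have "\<dots> = c0 ^ n0 * \<phi>0 1 * 1" by simp
    also have "\<dots> \<le> c0 ^ n0 * \<phi>0 1 * (c1 ^ n1 / \<phi>1 1 * \<phi>1 t)"
    proof (rule mult_left_mono)
      have "\<phi>1 1 \<le> c1 ^ n1 * \<phi>1 t" using low[OF t, of n1] n1 False by linarith
      then show "1 \<le> c1 ^ n1 / \<phi>1 1 * \<phi>1 t" using pos(2)[of 1] by (simp add: field_simps)
      show "0 \<le> c0 ^ n0 * \<phi>0 1" using ac0 pos(1)[of 1] by simp
    qed
    also have "\<dots> = M * \<phi>1 t" by (simp add: M_def)
    also have "\<dots> \<le> max K M * \<phi>1 t" using pos[OF t] by (intro mult_right_mono) auto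
    finally show ?thesis .
  qed
  show ?thesis
  proof (rule that[of "1 / max K M"])
    show "0 < 1 / max K M" using K by simp
    show "1 / max K M * \<phi>0 t \<le> \<phi>1 t" if "1 \<le> t" for t
    proof -
      have "0 < max K M" using K by simp
      then show ?thesis using le[OF that] by (simp add: divide_le_eq mult.commute)
    qed
  qed
qed

text \<open>
  The quotient \<open>q = \<phi>1 / \<phi>0\<close> stays above \<open>r\<close> and changes at most by the factor \<open>c0 * c1\<close> in one step,
  so \<open>\<psi>(q)\<close> changes at most by the constant \<open>C\<close> of comparable arguments.
\<close>

lemma RO_interpolate:
  assumes \<phi>0: "\<phi>0 \<in> RO" and \<phi>1: "\<phi>1 \<in> RO" and \<psi>: "interpolation_parameter \<psi>"
    and r: "0 < r" "\<And>t. 1 \<le> t \<Longrightarrow> r * \<phi>0 t \<le> \<phi>1 t"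
  shows "(\<lambda>t. \<phi>0 t * \<psi> (\<phi>1 t / \<phi>0 t)) \<in> RO"
proof -
  let ?\<phi> = "\<lambda>t. \<phi>0 t * \<psi> (\<phi>1 t / \<phi>0 t)"
  obtain a0 c0 where ac0: "1 < a0" "1 \<le> c0"
    and up0: "\<And>s t. 1 \<le> t \<Longrightarrow> 1 \<le> s \<Longrightarrow> s \<le> a0 \<Longrightarrow> \<phi>0 (s * t) \<le> c0 * \<phi>0 t"
    and low0: "\<And>s t. 1 \<le> t \<Longrightarrow> 1 \<le> s \<Longrightarrow> s \<le> a0 \<Longrightarrow> \<phi>0 t \<le> c0 * \<phi>0 (s * t)"
    using RO_step[OF \<phi>0] by blast
  obtain a1 c1 where ac1: "1 < a1" "1 \<le> c1"
    and up1: "\<And>s t. 1 \<le> t \<Longrightarrow> 1 \<le> s \<Longrightarrow> s \<le> a1 \<Longrightarrow> \<phi>1 (s * t) \<le> c1 * \<phi>1 t"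
    and low1: "\<And>s t. 1 \<le> t \<Longrightarrow> 1 \<le> s \<Longrightarrow> s \<le> a1 \<Longrightarrow> \<phi>1 t \<le> c1 * \<phi>1 (s * t)"
    using RO_step[OF \<phi>1] by blast
  have "1 * 1 \<le> c0 * c1" using ac0 ac1 by (intro mult_mono) auto
  then have "1 \<le> c0 * c1" by simp
  then obtain C where C: "1 \<le> C" and comparable:
    "\<And>s t. r \<le> s \<Longrightarrow> r \<le> t \<Longrightarrow> t \<le> c0 * c1 * s \<Longrightarrow> s \<le> c0 * c1 * t \<Longrightarrow> \<psi> t \<le> C * \<psi> s"
    using interpolation_parameter_comparable[OF \<psi> r(1)] by blast
  have \<psi>B: "\<psi> \<in> class_B" using \<psi> by (simp add: interpolation_parameter_def)
  have \<psi>_pos: "0 < \<psi> t" if "0 < t" for t using \<psi>B that by (simp add: class_B_def)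
  note pos0 = RO_pos[OF \<phi>0] and pos1 = RO_pos[OF \<phi>1]
  define q where "q t = \<phi>1 t / \<phi>0 t" for t
  have q_ge: "r \<le> q t" if "1 \<le> t" for t
    using r(2)[OF that] pos0[OF that] by (simp add: q_def field_simps)
  have q_pos: "0 < q t" if "1 \<le> t" for t using q_ge[OF that] r(1) by linarith
  have \<phi>_pos: "0 < ?\<phi> t" if "1 \<le> t" for t
    using pos0[OF that] \<psi>_pos[OF q_pos[OF that]] by (simp add: q_def)
  have bounds: "?\<phi> (s * t) \<le> c0 * C * ?\<phi> t \<and> ?\<phi> t \<le> c0 * C * ?\<phi> (s * t)"
    if t: "1 \<le> t" and s: "1 \<le> s" "s \<le> a0" "s \<le> a1" for s t
  proof -
    have st: "1 \<le> s * t" using mult_mono[of 1 s 1 t] s t by simp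
    have p: "0 < \<phi>0 t" "0 < \<phi>0 (s * t)" "0 < \<phi>1 t" "0 < \<phi>1 (s * t)"
      using pos0 pos1 t st by auto
    have "\<phi>1 (s * t) * \<phi>0 t \<le> (c1 * \<phi>1 t) * (c0 * \<phi>0 (s * t))"
      using up1[OF t s(1,3)] low0[OF t s(1,2)] p ac1 by (intro mult_mono) auto
    then have q1: "q (s * t) \<le> c0 * c1 * q t" using p by (simp add: q_def field_simps)
    have "\<phi>1 t * \<phi>0 (s * t) \<le> (c1 * \<phi>1 (s * t)) * (c0 * \<phi>0 t)"
      using low1[OF t s(1,3)] up0[OF t s(1,2)] p ac1 by (intro mult_mono) auto
    then have q2: "q t \<le> c0 * c1 * q (s * t)" using p by (simp add: q_def field_simps)
    have \<psi>1: "\<psi> (q (s * t)) \<le> C * \<psi> (q t)" and \<psi>2: "\<psi> (q t) \<le> C * \<psi> (q (s * t))"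
      using comparable q_ge t st q1 q2 by blast+
    have "\<phi>0 (s * t) * \<psi> (q (s * t)) \<le> (c0 * \<phi>0 t) * (C * \<psi> (q t))"
      using up0[OF t s(1,2)] \<psi>1 p ac0 \<psi>_pos[OF q_pos[OF st]] by (intro mult_mono) auto
    moreover have "\<phi>0 t * \<psi> (q t) \<le> (c0 * \<phi>0 (s * t)) * (C * \<psi> (q (s * t)))"
      using low0[OF t s(1,2)] \<psi>2 p ac0 \<psi>_pos[OF q_pos[OF t]] by (intro mult_mono) auto
    ultimately show ?thesis by (simp add: q_def mult_ac)
  qed
  have "\<psi> \<in> borel_measurable (restrict_space borel {0<..})"
    and meas: "\<phi>0 \<in> borel_measurable (restrict_space borel {1..})"
      "\<phi>1 \<in> borel_measurable (restrict_space borel {1..})"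
    using \<psi>B \<phi>0 \<phi>1 by (simp_all add: class_B_def RO_def)
  moreover have "q \<in> restrict_space borel {1..} \<rightarrow>\<^sub>M restrict_space borel {0<..}"
  proof (rule measurable_restrict_space2)
    show "q \<in> space (restrict_space borel {1..}) \<rightarrow> {0<..}"
      using q_pos by (auto simp: space_restrict_space)
    show "q \<in> borel_measurable (restrict_space borel {1..})"
      unfolding q_def using meas by measurable
  qed
  ultimately have "(\<lambda>t. \<psi> (q t)) \<in> borel_measurable (restrict_space borel {1..})"
    using measurable_compose by blast
  then have "?\<phi> \<in> borel_measurable (restrict_space borel {1..})"
    unfolding q_def using meas(1) by measurable
  moreover have "\<exists>a>1. \<exists>c\<ge>1. \<forall>t\<ge>1. \<forall>s\<in>{1..a}. 1 / c \<le> ?\<phi> (s * t) / ?\<phi> t \<and> ?\<phi> (s * t) / ?\<phi> t \<le> c"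
  proof (rule exI[of _ "min a0 a1"], intro exI[of _ "c0 * C"] conjI allI ballI impI)
    show "1 < min a0 a1" using ac0 ac1 by simp
    have "1 * 1 \<le> c0 * C" using ac0 C by (intro mult_mono) auto
    then show c: "1 \<le> c0 * C" by simp
    fix t s :: real assume t: "1 \<le> t" and s: "s \<in> {1..min a0 a1}"
    have st: "1 \<le> s * t" using mult_mono[of 1 s 1 t] s t by simp
    note b = bounds[OF t, of s]
    show "?\<phi> (s * t) / ?\<phi> t \<le> c0 * C"
      using b s by (subst pos_divide_le_eq[OF \<phi>_pos[OF t]]) auto
    have "?\<phi> t \<le> ?\<phi> (s * t) * (c0 * C)" using b s by (auto simp: mult.commute)
    then have "1 / (c0 * C) * ?\<phi> t \<le> ?\<phi> (s * t)"
      using c by (simp add: pos_divide_le_eq)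
    then show "1 / (c0 * C) \<le> ?\<phi> (s * t) / ?\<phi> t"
      by (subst pos_le_divide_eq[OF \<phi>_pos[OF t]])
  qed
  ultimately show ?thesis using \<phi>_pos unfolding RO_def by blast
qed

section \<open>Interpolation of the spaces on the lattice\<close>

lemma bracket_ge_1: "1 \<le> bracket k"
  by (simp add: bracket_def)

text \<open>
  Each coordinate of \<open>u\<close> is at most \<open>\<parallel>u\<parallel> / \<phi>(\<langle>k\<rangle>)\<close>, which grows at most polynomially, so membership in
  the weighted space implies that \<open>u\<close> is tempered.
\<close>

lemma H_space_eq_weighted_l2:
  assumes \<phi>: "\<phi> \<in> RO"
  shows "H_space \<phi> = weighted_l2 (\<lambda>k :: int ^ 'n::finite. \<phi> (bracket k))"
proof -
  interpret positive_weight "\<lambda>k :: int ^ 'n. \<phi> (bracket k)"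
    by unfold_locales (rule RO_pos[OF \<phi> bracket_ge_1])
  obtain C N where C: "0 < C" "\<And>t. 1 \<le> t \<Longrightarrow> 1 \<le> C * t ^ N * \<phi> t"
    using RO_polynomial_lower_bound[OF \<phi>] by blast
  have "u \<in> tempered" if u: "u \<in> hcarrier L" for u
  proof -
    have "cmod (u k) \<le> (hnorm L u * C) * bracket k ^ N" for k
    proof -
      have "1 * cmod (u k) \<le> C * bracket k ^ N * \<phi> (bracket k) * cmod (u k)"
        by (rule mult_right_mono[OF C(2)[OF bracket_ge_1]]) simp
      also have "\<dots> = C * bracket k ^ N * (\<phi> (bracket k) * cmod (u k))" by simp
      also have "\<dots> \<le> C * bracket k ^ N * hnorm L u"
        using C(1) bracket_ge_1[of k] by (intro mult_left_mono coordinate_le[OF u]) auto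
      finally show ?thesis by (simp add: mult_ac)
    qed
    then show ?thesis unfolding tempered_def by blast
  qed
  then show ?thesis by (auto simp: H_space_def weighted_l2_def)
qed

theorem theorem2p3:
  fixes \<phi>0 \<phi>1 \<psi> :: "real \<Rightarrow> real"
  assumes "\<phi>0 \<in> RO" and "\<phi>1 \<in> RO"
    and "Bfun (\<lambda>t. \<phi>0 t / \<phi>1 t) at_top"
    and "interpolation_parameter \<psi>"
  shows "admissible_pair (H_space \<phi>0 :: (int ^ 'n::finite \<Rightarrow> complex) hspace) (H_space \<phi>1) \<and>
    (let \<phi> = (\<lambda>t. \<phi>0 t * \<psi> (\<phi>1 t / \<phi>0 t)) in
      \<phi> \<in> RO \<and>
      equal_up_to_norm_equivalence
        (interpolation_space (H_space \<phi>0 :: (int ^ 'n \<Rightarrow> complex) hspace) (H_space \<phi>1) \<psi>)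
        (H_space \<phi>))"
proof -
  obtain r where r: "0 < r" "\<And>t. 1 \<le> t \<Longrightarrow> r * \<phi>0 t \<le> \<phi>1 t"
    using RO_ratio_lower_bound[OF assms(1-3)] by blast
  interpret weight_pair "\<lambda>k :: int ^ 'n. \<phi>0 (bracket k)" "\<lambda>k. \<phi>1 (bracket k)" r
    by unfold_locales (use r RO_pos[OF assms(1)] bracket_ge_1 in auto)
  let ?\<phi> = "\<lambda>t. \<phi>0 t * \<psi> (\<phi>1 t / \<phi>0 t)"
  have RO: "?\<phi> \<in> RO" by (rule RO_interpolate[OF assms(1,2,4) r])
  have \<psi>: "\<psi> \<in> class_B" using assms(4) by (simp add: interpolation_parameter_def)
  have eqs: "H_space \<phi>0 = H0" "H_space \<phi>1 = H1"
    using assms(1,2) by (simp_all add: H_space_eq_weighted_l2)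
  have eq: "H_space ?\<phi> = weighted_l2 (\<lambda>k. \<phi>0 (bracket k) * \<psi> (m k))"
    using H_space_eq_weighted_l2[OF RO] by (simp add: m_def)
  have "equal_up_to_norm_equivalence (interpolation_space H0 H1 \<psi>) (H_space ?\<phi>)"
    unfolding equal_up_to_norm_equivalence_def eq interpolation_space_weighted(1)[OF \<psi>]
    by (auto simp: interpolation_space_weighted(2)[OF \<psi>] intro!: exI[of _ "1::real"])
  then show ?thesis
    using admissible RO by (simp add: Let_def eqs)
qed

end
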